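(* Let $d=3$, $p\in[1,\infty]$ and $\delta\in(0,\delta_0]$. Then (i) $\nabla\mathcal K_\delta^{\mathrm g}f=\mathcal K_\delta^{\mathrm c}\nabla f$ for all $f\in Z^{\mathrm g,p}(D)$; (ii) $\nabla\times\mathcal K_\delta^{\mathrm c}\mathbf g=\mathcal K_\delta^{\mathrm d}\nabla\times\mathbf g$ for all $\mathbf g\in\mathbf Z^{\mathrm c,p}(D)$; (iii) $\nabla\cdot\mathcal K_\delta^{\mathrm d}\mathbf g=\mathcal K_\delta^{\mathrm b}\nabla\cdot\mathbf g$ for all $\mathbf g\in\mathbf Z^{\mathrm d,p}(D)$. That is, $\mathcal K_\delta^{\mathrm g},\mathcal K_\delta^{\mathrm c},\mathcal K_\delta^{\mathrm d},\mathcal K_\delta^{\mathrm b}$ form a commuting diagram from the complex $Z^{\mathrm g,p}(D)\xrightarrow{\nabla}\mathbf Z^{\mathrm c,p}(D)\xrightarrow{\nabla\times}\mathbf Z^{\mathrm d,p}(D)\xrightarrow{\nabla\cdot}L^p(D)$ to the complex $C^\infty(D)\xrightarrow{\nabla}\mathbf C^\infty(D)\xrightarrow{\nabla\times}\mathbf C^\infty(D)\xrightarrow{\nabla\cdot}C^\infty(D)$.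
   Context: $D\subset\mathbb R^d$ ($d=3$) is an open, bounded, connected, strongly Lipschitz set. Boldface spaces are spaces of $\mathbb R^d$-valued fields. $B(\mathbf x,\rho)$ denotes the open Euclidean ball and $\|\cdot\|_{\ell^2}$ the Euclidean norm and induced matrix norm. Let $\mathbf j\in C^\infty(\mathbb R^d;\mathbb R^d)$ be a fixed vector field with $\|\mathbf j\|_{\ell^2}=1$ on $\partial D$ that is globally transversal: there is $\gamma>0$ with $\mathbf n\cdot\mathbf j\ge\gamma$ a.e. on $\partial D$, $\mathbf n$ being the outward unit normal. Set $\boldsymbol\varphi_\delta(\mathbf x)=\mathbf x-\delta\,\mathbf j(\mathbf x)$, and let $r>0$ be fixed such that $\boldsymbol\varphi_\delta(D)+B(\mathbf 0,\delta r)\subset D$ for all $\delta\in[0,1]$ (for $\delta=0$ the ball is understood as $\{\mathbf 0\}$). Let $\mathbb J_\delta(\mathbf x)$ be the Jacobian matrix of $\boldsymbol\varphi_\delta$ at $\mathbf x$, and let $\delta_0\in(0,1]$ be such that $\|\mathbb J_\delta(\mathbf x)-\mathbb I\|_{\ell^2}\le\frac12$, $\|\mathbb J_\delta^{-1}(\mathbf x)\|_{\ell^2}\le 2$ and $|\det(\mathbb J_\delta^{-1}(\mathbf x))|\le 2^d$ for all $\delta\in[0,\delta_0]$, $\mathbf x\in D$. The kernel is $\rho(\mathbf y)=\eta\exp\left(-\frac{1}{1-\|\mathbf y\|_{\ell^2}^2}\right)$ if $\|\mathbf y\|_{\ell^2}<1$, $\rho(\mathbf y)=0$ otherwise, with $\eta$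 such that $\int_{\mathbb R^d}\rho=1$. For $f\in L^1(D)$, $\mathbf g\in L^1(D;\mathbb R^d)$, $\mathbf x\in D$: $$(\mathcal K_\delta^{\mathrm g}f)(\mathbf x)=\int_{B(\mathbf 0,1)}\rho(\mathbf y)f(\boldsymbol\varphi_\delta(\mathbf x)+\delta r\mathbf y)\,d\mathbf y,$$ $$(\mathcal K_\delta^{\mathrm c}\mathbf g)(\mathbf x)=\int_{B(\mathbf 0,1)}\rho(\mathbf y)\mathbb J_\delta^{\mathsf T}(\mathbf x)\mathbf g(\boldsymbol\varphi_\delta(\mathbf x)+\delta r\mathbf y)\,d\mathbf y,$$ $$(\mathcal K_\delta^{\mathrm d}\mathbf g)(\mathbf x)=\int_{B(\mathbf 0,1)}\rho(\mathbf y)\det(\mathbb J_\delta(\mathbf x))\mathbb J_\delta^{-1}(\mathbf x)\mathbf g(\boldsymbol\varphi_\delta(\mathbf x)+\delta r\mathbf y)\,d\mathbf y,$$ $$(\mathcal K_\delta^{\mathrm b}f)(\mathbf x)=\int_{B(\mathbf 0,1)}\rho(\mathbf y)\det(\mathbb J_\delta(\mathbf x))f(\boldsymbol\varphi_\delta(\mathbf x)+\delta r\mathbf y)\,d\mathbf y.$$ Spaces (weak derivatives): $Z^{\mathrm g,p}(D)=\{f\in L^p(D):\nabla f\in\mathbf L^p(D)\}$, $\mathbf Z^{\mathrm c,p}(D)=\{\mathbf v\in\mathbf L^p(D):\nabla\times\mathbf v\in\mathbf L^p(D)\}$, $\mathbf Z^{\mathrm d,p}(D)=\{\mathbf v\in\mathbf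 L^p(D):\nabla\cdot\mathbf v\in L^p(D)\}$. *)

theory Defs
  imports "HOL-Analysis.Analysis"
begin

section \<open>Smooth functions and classical differential operators\<close>

text \<open>Only meaningful for open \<open>S\<close>, since derivatives are taken at full neighbourhoods.\<close>

primrec higher_differentiable_on ::
    "nat \<Rightarrow> 'a::real_normed_vector set \<Rightarrow> ('a \<Rightarrow> 'b::real_normed_vector) \<Rightarrow> bool" where
  "higher_differentiable_on 0 S f \<longleftrightarrow> continuous_on S f"
| "higher_differentiable_on (Suc k) S f \<longleftrightarrow>
     (\<forall>x\<in>S. f differentiable (at x)) \<and>
     (\<forall>v. higher_differentiable_on k S (\<lambda>x. frechet_derivative f (at x) v))"

definition smooth_on :: "'a::real_normed_vector set \<Rightarrow> ('a \<Rightarrow> 'b::real_normed_vector) \<Rightarrow> bool" where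
  "smooth_on S f \<longleftrightarrow> (\<forall>k. higher_differentiable_on k S f)"

definition grad :: "(real^'n \<Rightarrow> real) \<Rightarrow> real^'n \<Rightarrow> real^'n" where
  "grad f x = (\<chi> i. frechet_derivative f (at x) (axis i 1))"

text \<open>The entry \<open>jacobian v (at x) $ i $ k\<close> is the partial derivative of \<open>v\<^sub>i\<close> in direction \<open>k\<close>.\<close>

definition curl :: "(real^3 \<Rightarrow> real^3) \<Rightarrow> real^3 \<Rightarrow> real^3" where
  "curl v x = (let J = jacobian v (at x) in
     vector [J$3$2 - J$2$3, J$1$3 - J$3$1, J$2$1 - J$1$2])"

definition divergence :: "(real^'n \<Rightarrow> real^'n) \<Rightarrow> real^'n \<Rightarrow> real" where
  "divergence v x = trace (jacobian v (at x))"


section \<open>Lebesgue spaces and weak derivatives\<close>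

text \<open>Elements of \<open>L\<^sup>p(D)\<close> are represented by functions on the whole space whose values outside
  \<open>D\<close> are irrelevant; functions that agree almost everywhere on \<open>D\<close> are not identified.\<close>

definition Lp :: "ennreal \<Rightarrow> 'a::euclidean_space set \<Rightarrow> ('a \<Rightarrow> 'b::euclidean_space) set" where
  "Lp p D = {f. set_borel_measurable lebesgue D f \<and>
     (if p = \<infinity> then \<exists>C. AE x in lebesgue. x \<in> D \<longrightarrow> norm (f x) \<le> C
      else set_integrable lebesgue D (\<lambda>x. norm (f x) powr enn2real p))}"

definition locally_integrable_on ::
    "'a::euclidean_space set \<Rightarrow> ('a \<Rightarrow> 'b::euclidean_space) \<Rightarrow> bool" where
  "locally_integrable_on D f \<longleftrightarrow> (\<forall>K. compact K \<and> K \<subseteq> D \<longrightarrow> set_integrable lebesgue K f)"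

definition test_functions ::
    "'a::real_normed_vector set \<Rightarrow> ('a \<Rightarrow> 'b::real_normed_vector) set" where
  "test_functions D = {\<phi>. smooth_on UNIV \<phi> \<and>
     compact (closure {x. \<phi> x \<noteq> 0}) \<and> closure {x. \<phi> x \<noteq> 0} \<subseteq> D}"

text \<open>Weak derivatives are only determined up to null sets, so they are relations.\<close>

definition has_weak_grad :: "(real^'n) set \<Rightarrow> (real^'n \<Rightarrow> real) \<Rightarrow> (real^'n \<Rightarrow> real^'n) \<Rightarrow> bool" where
  "has_weak_grad D f h \<longleftrightarrow> locally_integrable_on D f \<and> locally_integrable_on D h \<and>
     (\<forall>\<phi>\<in>test_functions D.
        (LINT x:D|lebesgue. f x *\<^sub>R grad \<phi> x) = - (LINT x:D|lebesgue. \<phi> x *\<^sub>R h x))"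

definition has_weak_curl :: "(real^3) set \<Rightarrow> (real^3 \<Rightarrow> real^3) \<Rightarrow> (real^3 \<Rightarrow> real^3) \<Rightarrow> bool" where
  "has_weak_curl D v w \<longleftrightarrow> locally_integrable_on D v \<and> locally_integrable_on D w \<and>
     (\<forall>\<psi>\<in>test_functions D.
        (LINT x:D|lebesgue. v x \<bullet> curl \<psi> x) = (LINT x:D|lebesgue. w x \<bullet> \<psi> x))"

definition has_weak_div :: "(real^'n) set \<Rightarrow> (real^'n \<Rightarrow> real^'n) \<Rightarrow> (real^'n \<Rightarrow> real) \<Rightarrow> bool" where
  "has_weak_div D v w \<longleftrightarrow> locally_integrable_on D v \<and> locally_integrable_on D w \<and>
     (\<forall>\<phi>\<in>test_functions D.
        (LINT x:D|lebesgue. v x \<bullet> grad \<phi> x) = - (LINT x:D|lebesgue. w x * \<phi> x))"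

definition Zg :: "ennreal \<Rightarrow> (real^'n) set \<Rightarrow> (real^'n \<Rightarrow> real) set" where
  "Zg p D = {f \<in> Lp p D. \<exists>h\<in>Lp p D. has_weak_grad D f h}"

definition Zc :: "ennreal \<Rightarrow> (real^3) set \<Rightarrow> (real^3 \<Rightarrow> real^3) set" where
  "Zc p D = {v \<in> Lp p D. \<exists>w\<in>Lp p D. has_weak_curl D v w}"

definition Zd :: "ennreal \<Rightarrow> (real^'n) set \<Rightarrow> (real^'n \<Rightarrow> real^'n) set" where
  "Zd p D = {v \<in> Lp p D. \<exists>w\<in>Lp p D. has_weak_div D v w}"


section \<open>Strongly Lipschitz sets, outward normal, transversality\<close>

text \<open>
  \<open>D\<close> coincides near its boundary point \<open>z\<close> with the strict epigraph, in direction \<open>e\<close>, of a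
  Lipschitz function \<open>\<zeta>\<close> on the hyperplane orthogonal to \<open>e\<close>. A point \<open>x\<close> near \<open>z\<close> is written as
  \<open>x = z + x' + t e\<close> with \<open>x'\<close> orthogonal to \<open>e\<close>.
\<close>

definition lipschitz_graph_at ::
    "'a::euclidean_space set \<Rightarrow> 'a \<Rightarrow> 'a \<Rightarrow> ('a \<Rightarrow> real) \<Rightarrow> bool" where
  "lipschitz_graph_at D z e \<zeta> \<longleftrightarrow> norm e = 1 \<and>
     (\<exists>L \<alpha> \<beta>. 0 < \<alpha> \<and> 0 < \<beta> \<and>
        L-lipschitz_on {x'. x' \<bullet> e = 0 \<and> norm x' < \<alpha>} \<zeta> \<and>
        (\<forall>x' t. x' \<bullet> e = 0 \<and> norm x' < \<alpha> \<and> \<bar>t\<bar> < \<beta> \<longrightarrow>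
           (z + x' + t *\<^sub>R e \<in> D \<longleftrightarrow> \<zeta> x' < t)))"

definition strongly_lipschitz :: "'a::euclidean_space set \<Rightarrow> bool" where
  "strongly_lipschitz D \<longleftrightarrow> (\<forall>z\<in>frontier D. \<exists>e \<zeta>. lipschitz_graph_at D z e \<zeta>)"

text \<open>
  Locally \<open>D\<close> is the set where \<open>\<zeta>(x') - t < 0\<close>. If \<open>\<zeta>\<close> is differentiable at \<open>0\<close> with tangential
  gradient \<open>G\<close>, the outward normal at \<open>z\<close> is therefore the normalisation of \<open>G - e\<close>.
\<close>

definition outward_unit_normal :: "'a::euclidean_space set \<Rightarrow> 'a \<Rightarrow> 'a \<Rightarrow> bool" where
  "outward_unit_normal D z n \<longleftrightarrow> (\<exists>e \<zeta> G. lipschitz_graph_at D z e \<zeta> \<and> G \<bullet> e = 0 \<and>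
     (\<zeta> has_derivative (\<lambda>h. G \<bullet> h)) (at 0 within {x'. x' \<bullet> e = 0}) \<and>
     n = (G - e) /\<^sub>R norm (G - e))"

text \<open>The \<open>k\<close>-dimensional Hausdorff measure (\<open>k > 0\<close>), up to the usual normalisation constant;
  it is only used through its null sets.\<close>

definition hausdorff_measure :: "nat \<Rightarrow> 'a::metric_space set \<Rightarrow> ennreal" where
  "hausdorff_measure k A = (SUP \<epsilon>\<in>{0::real<..}.
     INF C\<in>{C :: nat \<Rightarrow> 'a set. A \<subseteq> (\<Union>i. C i) \<and> (\<forall>i. bounded (C i) \<and> diameter (C i) \<le> \<epsilon>)}.
       (\<Sum>i. ennreal (diameter (C i) ^ k)))"

definition globally_transversal :: "(real^'n) set \<Rightarrow> (real^'n \<Rightarrow> real^'n) \<Rightarrow> bool" where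
  "globally_transversal D j \<longleftrightarrow> (\<exists>\<gamma>>0.
     hausdorff_measure (CARD('n) - 1)
       {z \<in> frontier D. \<not> (\<exists>n. outward_unit_normal D z n \<and> n \<bullet> j z \<ge> \<gamma>)} = 0)"


section \<open>The mollification operators\<close>

definition matrix_norm :: "real^'n^'m \<Rightarrow> real" where
  "matrix_norm A = onorm (\<lambda>v. A *v v)"

definition shrink :: "(real^'n \<Rightarrow> real^'n) \<Rightarrow> real \<Rightarrow> real^'n \<Rightarrow> real^'n" where
  "shrink j \<delta> x = x - \<delta> *\<^sub>R j x"

definition Jac :: "(real^'n \<Rightarrow> real^'n) \<Rightarrow> real \<Rightarrow> real^'n \<Rightarrow> real^'n^'n" where
  "Jac j \<delta> x = jacobian (shrink j \<delta>) (at x)"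

definition bump :: "'a::euclidean_space \<Rightarrow> real" where
  "bump y = (if norm y < 1 then exp (- 1 / (1 - (norm y)\<^sup>2)) else 0)"

text \<open>The normalisation constant \<open>\<eta>\<close> is the reciprocal of the integral of \<open>bump\<close>.\<close>

definition kernel :: "'a::euclidean_space \<Rightarrow> real" where
  "kernel y = bump y / (LINT z|lebesgue. bump (z::'a))"

definition Kg :: "(real^'n \<Rightarrow> real^'n) \<Rightarrow> real \<Rightarrow> real \<Rightarrow> (real^'n \<Rightarrow> real) \<Rightarrow> real^'n \<Rightarrow> real" where
  "Kg j r \<delta> f x = (LINT y:ball 0 1|lebesgue.
     kernel y * f (shrink j \<delta> x + (\<delta> * r) *\<^sub>R y))"

definition Kc :: "(real^'n \<Rightarrow> real^'n) \<Rightarrow> real \<Rightarrow> real \<Rightarrow> (real^'n \<Rightarrow> real^'n) \<Rightarrow> real^'n \<Rightarrow> real^'n" where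
  "Kc j r \<delta> g x = (LINT y:ball 0 1|lebesgue.
     kernel y *\<^sub>R (transpose (Jac j \<delta> x) *v g (shrink j \<delta> x + (\<delta> * r) *\<^sub>R y)))"

definition Kd :: "(real^'n \<Rightarrow> real^'n) \<Rightarrow> real \<Rightarrow> real \<Rightarrow> (real^'n \<Rightarrow> real^'n) \<Rightarrow> real^'n \<Rightarrow> real^'n" where
  "Kd j r \<delta> g x = (LINT y:ball 0 1|lebesgue.
     (kernel y * det (Jac j \<delta> x)) *\<^sub>R
       (matrix_inv (Jac j \<delta> x) *v g (shrink j \<delta> x + (\<delta> * r) *\<^sub>R y)))"

definition Kb :: "(real^'n \<Rightarrow> real^'n) \<Rightarrow> real \<Rightarrow> real \<Rightarrow> (real^'n \<Rightarrow> real) \<Rightarrow> real^'n \<Rightarrow> real" where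
  "Kb j r \<delta> f x = (LINT y:ball 0 1|lebesgue.
     kernel y * det (Jac j \<delta> x) * f (shrink j \<delta> x + (\<delta> * r) *\<^sub>R y))"

end

theory Submission
  imports Defs
begin

text \<open>
  The substitution \<open>z = \<phi>\<^sub>\<delta>(x) + \<delta> r y\<close> turns each operator into a pullback along \<open>\<phi>\<^sub>\<delta>\<close> of the
  convolution of the field, extended by zero, with the smooth kernel scaled to radius \<open>\<delta> r\<close>. The
  convolution commutes with weak derivatives at every point whose closed ball of radius \<open>\<delta> r\<close> lies
  in \<open>D\<close>, because there the translated kernel is a test function; the points \<open>\<phi>\<^sub>\<delta>(x)\<close> have this
  property since \<open>\<phi>\<^sub>\<delta>\<close> is an open map. It remains to differentiate pullbacks of smooth fields: the
  chain rule, the symmetry of the second derivatives of \<open>\<phi>\<^sub>\<delta>\<close>, and the fact that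
  \<open>det J J\<inverse>\<close> is the adjugate of \<open>J\<close> give the transformation rules of gradient, curl and divergence.
\<close>


section \<open>Calculus of smooth functions\<close>

text \<open>The obstacle is the boundary of the balls. The hypothesis on \<open>r\<close> places
  only the open ball of radius \<open>\<delta> * r\<close> around an image in \<open>D\<close>,
  while the kernel is positive on that whole open ball, so the closure of its nonzero set is the
  closed ball, which might touch the frontier of \<open>D\<close>. Weak derivatives are tested only
  by functions with compact support inside \<open>D\<close>. Since the Jacobian is within 1/2 of the
  identity, it is invertible, so all points near an image are images as well, and their open balls
  cover the closed one.

  Two choices keep the calculus free of side conditions. Extended by zero, fields on the bounded set
  \<open>D\<close> become integrable on the whole space, so their convolutions are smooth everywhere
  and not only near the images. The adjugate is a polynomial in the entries of \<open>J\<close>: it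
  is smooth also where \<open>J\<close> is singular, and no inverse matrix has to be differentiated.
  Operators and pullbacks agree on \<open>D\<close> only, which suffices for derivatives because
  \<open>D\<close> is open.\<close>

lemma higher_differentiable_on_cong:
  assumes "open S" "\<And>x. x \<in> S \<Longrightarrow> f x = g x" "higher_differentiable_on k S f"
  shows "higher_differentiable_on k S g"
  using assms(2,3)
proof (induction k arbitrary: f g)
  case 0
  then show ?case by (simp cong: continuous_on_cong)
next
  case (Suc k)
  have d: "(g has_derivative frechet_derivative f (at x)) (at x)" if "x \<in> S" for x
    using Suc.prems that \<open>open S\<close>
    by (metis frechet_derivative_works has_derivative_transform_within_open higher_differentiable_on.simps(2))
  have eq: "frechet_derivative f (at x) = frechet_derivative g (at x)" if "x \<in> S" for x
    using frechet_derivative_at[OF d[OF that]] .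
  have "higher_differentiable_on k S (\<lambda>x. frechet_derivative g (at x) v)" for v
    
  proof (rule Suc.IH)
    show "higher_differentiable_on k S (\<lambda>x. frechet_derivative f (at x) v)"
      using Suc.prems(2) by simp
  qed (simp add: eq)
  then show ?case using d by (metis differentiableI higher_differentiable_on.simps(2))
qed

text \<open>Lets the derivative be supplied as an explicit family \<open>f'\<close> instead of
  through \<open>frechet_derivative\<close>. The closure properties below are inductions on the
  order that feed the classical differentiation rules into this one.\<close>

lemma higher_differentiable_on_SucI:
  assumes "open S" "\<And>x. x \<in> S \<Longrightarrow> (f has_derivative f' x) (at x)"
    "\<And>v. higher_differentiable_on k S (\<lambda>x. f' x v)"
  shows "higher_differentiable_on (Suc k) S f"
proof -
  have "higher_differentiable_on k S (\<lambda>x. frechet_derivative f (at x) v)" for v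
    using frechet_derivative_at[OF assms(2)]
    by (intro higher_differentiable_on_cong[OF assms(1) _ assms(3)[of v]]) simp
  then show ?thesis using assms(2) by (metis differentiableI higher_differentiable_on.simps(2))
qed

text \<open>Product and chain rule leave some factors undifferentiated; these are needed at the
  lower order \<open>k\<close>. Only the base case has content: differentiable functions are
  continuous.\<close>

lemma higher_differentiable_on_SucD:
  "higher_differentiable_on (Suc k) S f \<Longrightarrow> higher_differentiable_on k S f"
proof (induction k arbitrary: f)
  case 0
  then show ?case
    by (simp add: continuous_at_imp_continuous_on differentiable_imp_continuous_within)
next
  case (Suc k)
  then show ?case by simp
qed

lemma higher_differentiable_on_has_derivative:
  "higher_differentiable_on (Suc k) S f \<Longrightarrow> x \<in> S
    \<Longrightarrow> (f has_derivative frechet_derivative f (at x)) (at x)"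
  by (simp add: frechet_derivative_works)

lemma higher_differentiable_on_const:
  assumes "open S"
  shows "higher_differentiable_on k S (\<lambda>x. c)"
proof (induction k arbitrary: c)
  case (Suc k)
  then show ?case
    by (intro higher_differentiable_on_SucI[OF assms, where f'="\<lambda>x h. 0"]) auto
qed simp

lemma higher_differentiable_on_linear:
  assumes "open S" "bounded_linear L" "higher_differentiable_on k S f"
  shows "higher_differentiable_on k S (\<lambda>x. L (f x))"
  using assms(3)
proof (induction k arbitrary: f)
  case 0
  then show ?case by (simp add: assms(2) bounded_linear.continuous_on)
next
  case (Suc k)
  show ?case
    using Suc.prems Suc.IH
    by (intro higher_differentiable_on_SucI[OF assms(1), of _ "\<lambda>x h. L (frechet_derivative f (at x) h)"]
        bounded_linear.has_derivative[OF assms(2) higher_differentiable_on_has_derivative[OF Suc.prems]])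
      simp_all
qed

lemma higher_differentiable_on_add:
  assumes "open S" "higher_differentiable_on k S f" "higher_differentiable_on k S g"
  shows "higher_differentiable_on k S (\<lambda>x. f x + g x)"
  using assms(2,3)
proof (induction k arbitrary: f g)
  case 0
  then show ?case by (auto intro: continuous_on_add)
next
  case (Suc k)
  show ?case
    using Suc.prems Suc.IH
    by (intro higher_differentiable_on_SucI[OF assms(1),
          of _ "\<lambda>x h. frechet_derivative f (at x) h + frechet_derivative g (at x) h"]
        has_derivative_add higher_differentiable_on_has_derivative[OF Suc.prems(1)]
        higher_differentiable_on_has_derivative[OF Suc.prems(2)]) simp_all
qed

lemma higher_differentiable_on_bilinear:
  assumes "open S" "bounded_bilinear B"
    "higher_differentiable_on k S f" "higher_differentiable_on k S g"
  shows "higher_differentiable_on k S (\<lambda>x. B (f x) (g x))"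
  using assms(3,4)
proof (induction k arbitrary: f g)
  case 0
  then show ?case by (simp add: bounded_bilinear.continuous_on[OF assms(2)])
next
  case (Suc k)
  show ?case
    using Suc.prems[THEN higher_differentiable_on_SucD] Suc.prems Suc.IH
    by (intro higher_differentiable_on_SucI[OF assms(1),
          of _ "\<lambda>x h. B (f x) (frechet_derivative g (at x) h) + B (frechet_derivative f (at x) h) (g x)"]
        bounded_bilinear.FDERIV[OF assms(2)] higher_differentiable_on_has_derivative[OF Suc.prems(1)]
        higher_differentiable_on_has_derivative[OF Suc.prems(2)]
        higher_differentiable_on_add[OF assms(1)]) simp_all
qed

lemma higher_differentiable_on_sum:
  assumes "open S" "\<And>i. i \<in> I \<Longrightarrow> higher_differentiable_on k S (f i)"
  shows "higher_differentiable_on k S (\<lambda>x. \<Sum>i\<in>I. f i x)"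
  using assms(2)
  by (induction I rule: infinite_finite_induct)
    (auto intro!: higher_differentiable_on_const higher_differentiable_on_add assms(1))

text \<open>The derivative of the composition is that of \<open>f\<close> in a direction which
  varies with \<open>x\<close>, whereas the induction hypothesis covers fixed directions only.
  Expanding the direction in the basis of the Euclidean middle space gives a sum of products to
  which the hypothesis applies, with a directional derivative of \<open>f\<close> in the place of
  \<open>f\<close>.\<close>

lemma higher_differentiable_on_compose:
  fixes g :: "'a::real_normed_vector \<Rightarrow> 'b::euclidean_space"
  assumes "open S" "open T" "g ` S \<subseteq> T"
    "higher_differentiable_on k T f" "higher_differentiable_on k S g"
  shows "higher_differentiable_on k S (\<lambda>x. f (g x))"
  using assms(4,5)
proof (induction k arbitrary: f)
  case 0
  then show ?case
    using assms(3) by (auto intro: continuous_on_compose2)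
next
  case (Suc k)
  let ?f' = "\<lambda>y. frechet_derivative f (at y)" and ?g' = "\<lambda>x. frechet_derivative g (at x)"
  have df: "(f has_derivative ?f' y) (at y)" if "y \<in> T" for y
    using Suc.prems(1) that by (rule higher_differentiable_on_has_derivative)
  have dg: "(g has_derivative ?g' x) (at x)" if "x \<in> S" for x
    using Suc.prems(2) that by (rule higher_differentiable_on_has_derivative)
  have exp: "?f' (g x) (?g' x v) = (\<Sum>b\<in>Basis. (?g' x v \<bullet> b) *\<^sub>R ?f' (g x) b)" if "x \<in> S" for x v
  proof -
    have "linear (?f' (g x))"
      using df[of "g x"] assms(3) that has_derivative_linear by blast
    then have "?f' (g x) (\<Sum>b\<in>Basis. (?g' x v \<bullet> b) *\<^sub>R b) = (\<Sum>b\<in>Basis. (?g' x v \<bullet> b) *\<^sub>R ?f' (g x) b)"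
      by (simp add: linear_sum linear_cmul)
    then show ?thesis by (simp add: euclidean_representation)
  qed
  show ?case
  proof (rule higher_differentiable_on_SucI[OF assms(1)])
    fix x assume "x \<in> S"
    then show "((\<lambda>x. f (g x)) has_derivative (\<lambda>v. ?f' (g x) (?g' x v))) (at x)"
      using assms(3) by (intro has_derivative_compose[OF dg df]) auto
  next
    fix v
    have "higher_differentiable_on k S (\<lambda>x. (\<Sum>b\<in>Basis. (?g' x v \<bullet> b) *\<^sub>R ?f' (g x) b))"
      using Suc.prems higher_differentiable_on_SucD[OF Suc.prems(2)]
      by (intro higher_differentiable_on_sum[OF assms(1)]
          higher_differentiable_on_bilinear[OF assms(1) bounded_bilinear_scaleR]
          higher_differentiable_on_linear[OF assms(1) bounded_linear_inner_left] Suc.IH) auto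
    then show "higher_differentiable_on k S (\<lambda>x. ?f' (g x) (?g' x v))"
      by (rule higher_differentiable_on_cong[OF assms(1), rotated]) (simp add: exp)
  qed
qed

section \<open>Closure properties of infinitely differentiable functions\<close>

lemma smooth_on_cong:
  "open S \<Longrightarrow> (\<And>x. x \<in> S \<Longrightarrow> f x = g x) \<Longrightarrow> smooth_on S f \<Longrightarrow> smooth_on S g"
  unfolding smooth_on_def by (blast intro: higher_differentiable_on_cong)

lemma smooth_on_const: "open S \<Longrightarrow> smooth_on S (\<lambda>x. c)"
  by (simp add: smooth_on_def higher_differentiable_on_const)

lemma smooth_on_linear: "open S \<Longrightarrow> bounded_linear L \<Longrightarrow> smooth_on S f \<Longrightarrow> smooth_on S (\<lambda>x. L (f x))"
  by (simp add: smooth_on_def higher_differentiable_on_linear)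

lemma smooth_on_add: "open S \<Longrightarrow> smooth_on S f \<Longrightarrow> smooth_on S g \<Longrightarrow> smooth_on S (\<lambda>x. f x + g x)"
  by (simp add: smooth_on_def higher_differentiable_on_add)

lemma smooth_on_bilinear:
  "open S \<Longrightarrow> bounded_bilinear B \<Longrightarrow> smooth_on S f \<Longrightarrow> smooth_on S g \<Longrightarrow> smooth_on S (\<lambda>x. B (f x) (g x))"
  by (simp add: smooth_on_def higher_differentiable_on_bilinear)

lemma smooth_on_sum:
  "open S \<Longrightarrow> (\<And>i. i \<in> I \<Longrightarrow> smooth_on S (f i)) \<Longrightarrow> smooth_on S (\<lambda>x. \<Sum>i\<in>I. f i x)"
  by (simp add: smooth_on_def higher_differentiable_on_sum)

lemma smooth_on_compose:
  fixes g :: "'a::real_normed_vector \<Rightarrow> 'b::euclidean_space"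
  shows "open S \<Longrightarrow> open T \<Longrightarrow> g ` S \<subseteq> T \<Longrightarrow> smooth_on T f \<Longrightarrow> smooth_on S g
    \<Longrightarrow> smooth_on S (\<lambda>x. f (g x))"
  unfolding smooth_on_def by (blast intro: higher_differentiable_on_compose)

lemma smooth_on_mult:
  fixes f g :: "'a::real_normed_vector \<Rightarrow> real"
  shows "open S \<Longrightarrow> smooth_on S f \<Longrightarrow> smooth_on S g \<Longrightarrow> smooth_on S (\<lambda>x. f x * g x)"
  by (rule smooth_on_bilinear[OF _ bounded_bilinear_mult])

lemma smooth_on_uminus: "open S \<Longrightarrow> smooth_on S f \<Longrightarrow> smooth_on S (\<lambda>x. - f x)"
  by (rule smooth_on_linear[OF _ bounded_linear_minus[OF bounded_linear_ident]])

lemma smooth_on_diff: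
  "open S \<Longrightarrow> smooth_on S f \<Longrightarrow> smooth_on S g \<Longrightarrow> smooth_on S (\<lambda>x. f x - g x)"
  using smooth_on_add[OF _ _ smooth_on_uminus, of S f g] by simp

lemma smooth_on_nth: "open S \<Longrightarrow> smooth_on S f \<Longrightarrow> smooth_on S (\<lambda>x. f x $ i)"
  by (rule smooth_on_linear[OF _ bounded_linear_vec_nth])

lemma smooth_on_vec:
  fixes f :: "'a::real_normed_vector \<Rightarrow> real^'n"
  assumes "open S" "\<And>i. smooth_on S (\<lambda>x. f x $ i)"
  shows "smooth_on S f"
proof -
  have "smooth_on S (\<lambda>x. \<Sum>i\<in>UNIV. f x $ i *\<^sub>R axis i (1::real))"
    using assms
    by (intro smooth_on_sum smooth_on_linear[OF _ bounded_linear_scaleR_left])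
  then show ?thesis
    by (rule smooth_on_cong[OF assms(1), rotated]) (simp add: basis_expansion flip: scalar_mult_eq_scaleR)
qed

lemma smooth_on_frechet:
  "smooth_on S f \<Longrightarrow> smooth_on S (\<lambda>x. frechet_derivative f (at x) v)"
  unfolding smooth_on_def using higher_differentiable_on.simps(2) by blast

lemma smooth_onI:
  assumes "\<And>x. x \<in> S \<Longrightarrow> f differentiable (at x)"
    "\<And>v. smooth_on S (\<lambda>x. frechet_derivative f (at x) v)"
  shows "smooth_on S f"
  unfolding smooth_on_def
proof
  fix k
  have "higher_differentiable_on (Suc k) S f"
    using assms unfolding smooth_on_def by auto
  then show "higher_differentiable_on k S f" by (rule higher_differentiable_on_SucD)
qed

lemma smooth_on_has_derivative:
  "smooth_on S f \<Longrightarrow> x \<in> S \<Longrightarrow> (f has_derivative frechet_derivative f (at x)) (at x)"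
  unfolding smooth_on_def using higher_differentiable_on_has_derivative by blast

lemma smooth_on_continuous_on: "smooth_on S f \<Longrightarrow> continuous_on S f"
  unfolding smooth_on_def using higher_differentiable_on.simps(1) by blast

lemma smooth_on_subset: "smooth_on S f \<Longrightarrow> T \<subseteq> S \<Longrightarrow> smooth_on T f"
proof -
  have "higher_differentiable_on k S f \<Longrightarrow> T \<subseteq> S \<Longrightarrow> higher_differentiable_on k T f" for k
  proof (induction k arbitrary: f)
    case 0
    then show ?case using continuous_on_subset by auto
  next
    case (Suc k)
    then show ?case by auto
  qed
  then show "smooth_on S f \<Longrightarrow> T \<subseteq> S \<Longrightarrow> smooth_on T f"
    by (simp add: smooth_on_def)
qed

lemma smooth_on_ident: "open S \<Longrightarrow> smooth_on S (\<lambda>x. x)"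
  by (rule smooth_onI) (simp_all add: smooth_on_const)

lemmas smooth_on_intros =
  smooth_on_const smooth_on_ident smooth_on_add smooth_on_diff smooth_on_uminus smooth_on_mult smooth_on_nth


section \<open>Symmetry of second derivatives\<close>

lemma has_derivative_along_line:
  assumes "(f has_derivative f') (at (a + t *\<^sub>R u))"
  shows "((\<lambda>t. f (a + t *\<^sub>R u)) has_derivative (\<lambda>h. h *\<^sub>R f' u)) (at t within T)"
proof -
  have "((\<lambda>t. a + t *\<^sub>R u) has_derivative (\<lambda>h. h *\<^sub>R u)) (at t within T)"
    by (auto intro!: derivative_eq_intros)
  from has_derivative_compose[OF this assms]
  have "((\<lambda>t. f (a + t *\<^sub>R u)) has_derivative (\<lambda>h. f' (h *\<^sub>R u))) (at t within T)" .
  moreover have "(\<lambda>h. f' (h *\<^sub>R u)) = (\<lambda>h. h *\<^sub>R f' u)"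
    using has_derivative_linear[OF assms] by (simp add: linear_cmul)
  ultimately show ?thesis by simp
qed

lemma mvt_along_line:
  fixes f :: "'a::real_normed_vector \<Rightarrow> real"
  assumes "s > 0" "\<And>t. 0 \<le> t \<Longrightarrow> t \<le> s \<Longrightarrow> (f has_derivative f' (a + t *\<^sub>R u)) (at (a + t *\<^sub>R u))"
  obtains t where "0 < t" "t < s" "f (a + s *\<^sub>R u) - f a = s * f' (a + t *\<^sub>R u) u"
proof -
  have "\<exists>t\<in>{0<..<s}. f (a + s *\<^sub>R u) - f (a + 0 *\<^sub>R u) = (s - 0) *\<^sub>R f' (a + t *\<^sub>R u) u"
    using assms by (intro mvt_simple[where f'="\<lambda>t h. h *\<^sub>R f' (a + t *\<^sub>R u) u"]
      has_derivative_along_line) auto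
  then show ?thesis using that by auto
qed

text \<open>The second difference of \<open>f\<close> at \<open>x\<close> is symmetric in \<open>u\<close> and \<open>v\<close>, and the mean value theorem,
  applied twice, expresses it through a value of \<open>D\<^sub>v D\<^sub>u f\<close> near \<open>x\<close>.\<close>

lemma second_difference:
  fixes f :: "'a::real_normed_vector \<Rightarrow> real"
  assumes "higher_differentiable_on 2 (ball x e) f" "s > 0" "s * (norm u + norm v) < e"
  obtains y where "dist x y \<le> s * (norm u + norm v)"
    "f (x + s *\<^sub>R u + s *\<^sub>R v) - f (x + s *\<^sub>R u) - (f (x + s *\<^sub>R v) - f x)
      = s * (s * frechet_derivative (\<lambda>x. frechet_derivative f (at x) u) (at y) v)"
proof -
  let ?f' = "\<lambda>x. frechet_derivative f (at x)"
  have mem: "x + a *\<^sub>R u + b *\<^sub>R v \<in> ball x e" "dist x (x + a *\<^sub>R u + b *\<^sub>R v) \<le> s * (norm u + norm v)"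
    if "0 \<le> a" "a \<le> s" "0 \<le> b" "b \<le> s" for a b
  proof -
    have "dist x (x + a *\<^sub>R u + b *\<^sub>R v) = norm (a *\<^sub>R u + b *\<^sub>R v)"
      by (metis add.assoc add_diff_cancel_left' dist_norm norm_minus_commute)
    also have "\<dots> \<le> a * norm u + b * norm v"
      using norm_triangle_ineq[of "a *\<^sub>R u" "b *\<^sub>R v"] that by simp
    also have "\<dots> \<le> s * (norm u + norm v)"
      using that by (simp add: distrib_left add_mono mult_right_mono)
    finally show "dist x (x + a *\<^sub>R u + b *\<^sub>R v) \<le> s * (norm u + norm v)" .
    then show "x + a *\<^sub>R u + b *\<^sub>R v \<in> ball x e" using assms(3) by simp
  qed
  have d1: "(f has_derivative ?f' z) (at z)" if "z \<in> ball x e" for z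
    using assms(1) that
    by (intro higher_differentiable_on_has_derivative[of 1 "ball x e"]) (simp_all add: numeral_2_eq_2)
  have d2: "((\<lambda>x. ?f' x u) has_derivative frechet_derivative (\<lambda>x. ?f' x u) (at z)) (at z)"
    if "z \<in> ball x e" for z
    using assms(1) that
    by (intro higher_differentiable_on_has_derivative[of 0 "ball x e"]) (simp_all add: numeral_2_eq_2)
  \<comment> \<open>Taking the difference in direction \<open>v\<close> first makes the mean value
    theorem in direction \<open>u\<close> return a difference of the \<open>u\<close>-derivative at
    two points \<open>s *\<^sub>R v\<close> apart, ready for the second application.\<close>
  define G where "G = (\<lambda>z. f (z + s *\<^sub>R v) - f z)"
  have dG: "(G has_derivative (\<lambda>h. ?f' (z + s *\<^sub>R v) h - ?f' z h)) (at z)"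
    if "z \<in> ball x e" "z + s *\<^sub>R v \<in> ball x e" for z
    unfolding G_def
    by (intro has_derivative_diff d1 that)
      (auto intro!: derivative_eq_intros has_derivative_compose[where g=f] d1 that)
  obtain a where a: "0 < a" "a < s"
    "G (x + s *\<^sub>R u) - G x = s * (?f' (x + a *\<^sub>R u + s *\<^sub>R v) u - ?f' (x + a *\<^sub>R u) u)"
  proof (rule mvt_along_line[OF assms(2), of G "\<lambda>z h. ?f' (z + s *\<^sub>R v) h - ?f' z h" x u])
    fix t assume "0 \<le> t" "t \<le> s"
    then show "(G has_derivative (\<lambda>h. ?f' (x + t *\<^sub>R u + s *\<^sub>R v) h - ?f' (x + t *\<^sub>R u) h))
        (at (x + t *\<^sub>R u))"
      using mem[of t 0] mem[of t s] assms(2) by (intro dG) auto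
  qed
  obtain b where b: "0 < b" "b < s"
    "?f' (x + a *\<^sub>R u + s *\<^sub>R v) u - ?f' (x + a *\<^sub>R u) u
      = s * frechet_derivative (\<lambda>x. ?f' x u) (at (x + a *\<^sub>R u + b *\<^sub>R v)) v"
  proof (rule mvt_along_line[OF assms(2), of "\<lambda>x. ?f' x u" "\<lambda>z. frechet_derivative (\<lambda>x. ?f' x u) (at z)" "x + a *\<^sub>R u" v])
    fix t assume "0 \<le> t" "t \<le> s"
    then show "((\<lambda>x. ?f' x u) has_derivative
          frechet_derivative (\<lambda>x. ?f' x u) (at (x + a *\<^sub>R u + t *\<^sub>R v))) (at (x + a *\<^sub>R u + t *\<^sub>R v))"
      using mem[of a t] a by (intro d2) auto
  qed
  show ?thesis
    using a b mem(2)[of a b] by (intro that[of "x + a *\<^sub>R u + b *\<^sub>R v"]) (auto simp: G_def)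
qed

text \<open>By the symmetry of the second difference, the two mixed derivatives take equal values at
  two points close to \<open>x\<close>; by continuity their values at \<open>x\<close> differ by
  less than any positive number.\<close>

lemma frechet_derivative_commute:
  fixes f :: "'a::real_normed_vector \<Rightarrow> real"
  assumes "open S" "smooth_on S f" "x \<in> S"
  shows "frechet_derivative (\<lambda>x. frechet_derivative f (at x) u) (at x) v
       = frechet_derivative (\<lambda>x. frechet_derivative f (at x) v) (at x) u"
proof -
  let ?F = "\<lambda>u v y. frechet_derivative (\<lambda>x. frechet_derivative f (at x) u) (at y) v"
  obtain e where e: "e > 0" "ball x e \<subseteq> S"
    using assms openE by blast
  have hd: "higher_differentiable_on 2 (ball x e) f"
    using smooth_on_subset[OF assms(2) e(2)] by (simp add: smooth_on_def)
  have cont: "continuous (at x) (?F u v)" for u v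
    using smooth_on_continuous_on[OF smooth_on_frechet[OF smooth_on_frechet[OF assms(2)]]] assms(1,3)
    by (simp add: continuous_on_eq_continuous_at)
  define c where "c = norm u + norm v"
  have approx: "\<bar>?F u v x - ?F v u x\<bar> < \<epsilon>" if "\<epsilon> > 0" for \<epsilon>
  proof -
    have "\<exists>d>0. \<forall>y. dist y x < d \<longrightarrow> dist (?F a b y) (?F a b x) < \<epsilon> / 2" for a b
      using cont[of a b] that unfolding continuous_at_eps_delta by (metis half_gt_zero)
    then obtain d1 d2 where d: "d1 > 0" "d2 > 0"
      "\<And>y. dist y x < d1 \<Longrightarrow> dist (?F u v y) (?F u v x) < \<epsilon> / 2"
      "\<And>y. dist y x < d2 \<Longrightarrow> dist (?F v u y) (?F v u x) < \<epsilon> / 2"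
      by meson
    define m where "m = min e (min d1 d2)"
    \<comment> \<open>The summand 1 keeps the denominator positive when \<open>u\<close> and
      \<open>v\<close> are both zero; the factor 2 gives the strict bound
      \<open>s * c < m\<close>.\<close>
    define s where "s = m / (2 * (c + 1))"
    have m: "m > 0" using d e by (simp add: m_def)
    have c: "c \<ge> 0" by (simp add: c_def)
    have s: "s > 0" using m c by (simp add: s_def)
    have "s * c \<le> s * (c + 1)" using s by simp
    also have "\<dots> = m / 2" using c by (simp add: s_def field_simps)
    also have "\<dots> < m" using m by simp
    finally have sc: "s * c < min e (min d1 d2)" by (simp add: m_def)
    obtain y where y: "dist x y \<le> s * c"
      "f (x + s *\<^sub>R u + s *\<^sub>R v) - f (x + s *\<^sub>R u) - (f (x + s *\<^sub>R v) - f x) = s * (s * ?F u v y)"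
      using second_difference[OF hd s, of u v] sc unfolding c_def by auto
    obtain z where z: "dist x z \<le> s * c"
      "f (x + s *\<^sub>R v + s *\<^sub>R u) - f (x + s *\<^sub>R v) - (f (x + s *\<^sub>R u) - f x) = s * (s * ?F v u z)"
      using second_difference[OF hd s, of v u] sc unfolding c_def by (auto simp: add.commute)
    have "s * (s * ?F u v y) = s * (s * ?F v u z)"
      using y z by (simp add: algebra_simps)
    then have "?F u v y = ?F v u z" using s by simp
    moreover have "dist (?F u v y) (?F u v x) < \<epsilon> / 2"
      using y sc by (intro d) (auto simp: dist_commute)
    moreover have "dist (?F v u z) (?F v u x) < \<epsilon> / 2"
      using z sc by (intro d) (auto simp: dist_commute)
    ultimately show ?thesis unfolding dist_real_def by linarith
  qed
  show ?thesis
    using approx[of "\<bar>?F u v x - ?F v u x\<bar>"] by force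
qed


section \<open>The bump function is smooth\<close>

text \<open>This family is closed under differentiation up to linear combinations, which gives smoothness
  of \<open>exp (- 1 / t)\<close> by induction without computing higher derivatives.\<close>

definition exp_inv_power :: "nat \<Rightarrow> real \<Rightarrow> real" where
  "exp_inv_power n t = (if t > 0 then (1 / t) ^ n * exp (- 1 / t) else 0)"

text \<open>From the left the function is constantly zero; from the right the substitution of the
  reciprocal turns it into a power divided by the exponential at infinity.\<close>

lemma exp_inv_power_tendsto_0: "(exp_inv_power n \<longlongrightarrow> 0) (at 0)"
proof (rule filterlim_split_at)
  show "(exp_inv_power n \<longlongrightarrow> 0) (at_left 0)"
    by (rule tendsto_eventually) (auto simp: exp_inv_power_def eventually_at_filter)
  have "((\<lambda>t. inverse t ^ n / exp (inverse t)) \<longlongrightarrow> (0::real)) (at_right 0)"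
    by (rule filterlim_compose[OF tendsto_power_div_exp_0 filterlim_inverse_at_top_right])
  then show "(exp_inv_power n \<longlongrightarrow> 0) (at_right 0)"
    by (rule Lim_transform_eventually)
      (auto simp: exp_inv_power_def eventually_at_filter exp_minus divide_inverse)
qed

lemma exp_inv_power_deriv:
  "(exp_inv_power n has_real_derivative exp_inv_power (n + 2) t - real n * exp_inv_power (n + 1) t) (at t)"
proof -
  consider "t > 0" | "t < 0" | "t = 0" by linarith
  then show ?thesis
  proof cases
    case 1
    have "((\<lambda>t. (1 / t) ^ n * exp (- 1 / t)) has_real_derivative
        exp_inv_power (n + 2) t - real n * exp_inv_power (n + 1) t) (at t)"
      using 1 by (cases n)
        (auto intro!: derivative_eq_intros simp: exp_inv_power_def field_simps power2_eq_square,
          metis One_nat_def mult.commute neq0_conv power_minus_mult)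
    then show ?thesis
      by (rule has_field_derivative_transform_within_open[of _ _ _ "{0<..}"])
        (use 1 in \<open>auto simp: exp_inv_power_def\<close>)
  next
    case 2
    have "((\<lambda>t. 0) has_real_derivative exp_inv_power (n + 2) t - real n * exp_inv_power (n + 1) t) (at t)"
      using 2 by (auto simp: exp_inv_power_def)
    then show ?thesis
      by (rule has_field_derivative_transform_within_open[of _ _ _ "{..<0}"])
        (use 2 in \<open>auto simp: exp_inv_power_def\<close>)
  next
    \<comment> \<open>At 0 the difference quotient of \<open>exp_inv_power n\<close> is
      \<open>exp_inv_power (Suc n)\<close> itself, whose limit is already known.\<close>
    case 3
    have "((\<lambda>h. (exp_inv_power n (0 + h) - exp_inv_power n 0) / h) \<longlongrightarrow> 0) (at 0)"
      by (rule Lim_transform_eventually[OF exp_inv_power_tendsto_0[of "Suc n"]])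
        (auto simp: exp_inv_power_def eventually_at_filter)
    then show ?thesis using 3 by (simp add: DERIV_def exp_inv_power_def)
  qed
qed

lemma smooth_on_exp_inv_power: "smooth_on UNIV (exp_inv_power n)"
proof -
  have "higher_differentiable_on k UNIV (exp_inv_power n)" for k n
  proof (induction k arbitrary: n)
    case 0
    show ?case
      by (simp add: continuous_at_imp_continuous_on DERIV_isCont[OF exp_inv_power_deriv])
  next
    case (Suc k)
    show ?case
    proof (rule higher_differentiable_on_SucI)
      show "(exp_inv_power n has_derivative
          (\<lambda>v. v * (exp_inv_power (n + 2) t + (- real n) * exp_inv_power (n + 1) t))) (at t)" for t
        using exp_inv_power_deriv[of n t] unfolding has_field_derivative_def
        by (simp add: mult.commute[of _ "_ - _"])
      show "higher_differentiable_on k UNIV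
          (\<lambda>t. v * (exp_inv_power (n + 2) t + (- real n) * exp_inv_power (n + 1) t))" for v
        by (intro higher_differentiable_on_add higher_differentiable_on_linear[OF _ bounded_linear_mult_right]
            Suc.IH open_UNIV)
    qed simp
  qed
  then show ?thesis by (simp add: smooth_on_def)
qed

text \<open>The inner product is a polynomial, whereas the norm is not differentiable at 0; in this
  form the bump is a composition of smooth maps.\<close>

lemma bump_eq: "bump y = exp_inv_power 0 (1 - y \<bullet> y)"
proof -
  have "norm y < 1 \<longleftrightarrow> 1 - y \<bullet> y > 0"
    by (simp add: norm_eq_sqrt_inner)
  then show ?thesis by (simp add: bump_def exp_inv_power_def power2_norm_eq_inner)
qed

lemma smooth_on_bump: "smooth_on UNIV (bump :: 'a::euclidean_space \<Rightarrow> real)"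
proof -
  have "smooth_on UNIV (\<lambda>y::'a. exp_inv_power 0 (1 - y \<bullet> y))"
    by (intro smooth_on_compose[OF _ _ _ smooth_on_exp_inv_power] smooth_on_intros
        smooth_on_bilinear[OF _ bounded_bilinear_inner]) auto
  then show ?thesis by (simp add: bump_eq[abs_def])
qed


section \<open>Test functions\<close>

lemma test_functionsI:
  assumes "smooth_on UNIV \<phi>" "{x. \<phi> x \<noteq> 0} \<subseteq> K" "compact K" "K \<subseteq> D"
  shows "\<phi> \<in> test_functions D"
proof -
  have "closure {x. \<phi> x \<noteq> 0} \<subseteq> K"
    using assms by (simp add: closure_minimal compact_imp_closed)
  moreover from this have "compact (closure {x. \<phi> x \<noteq> 0})"
    using assms(3) by (metis closed_closure compact_Int_closed inf.absorb_iff2)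
  ultimately show ?thesis
    using assms by (auto simp: test_functions_def)
qed

lemma test_functionsD:
  assumes "\<phi> \<in> test_functions D"
  obtains K where "compact K" "K \<subseteq> D" "\<And>x. x \<notin> K \<Longrightarrow> \<phi> x = 0" "\<And>S. smooth_on S \<phi>"
proof -
  have "\<phi> x = 0" if "x \<notin> closure {x. \<phi> x \<noteq> 0}" for x
    using that closure_subset[of "{x. \<phi> x \<noteq> 0}"] by auto
  moreover have "smooth_on UNIV \<phi>" "compact (closure {x. \<phi> x \<noteq> 0})" "closure {x. \<phi> x \<noteq> 0} \<subseteq> D"
    using assms by (simp_all add: test_functions_def)
  ultimately show ?thesis
    using smooth_on_subset[OF _ subset_UNIV] that by metis
qed

lemma test_functions_frechet:
  assumes "\<phi> \<in> test_functions D"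
  shows "(\<lambda>x. frechet_derivative \<phi> (at x) v) \<in> test_functions D"
proof -
  obtain K where K: "compact K" "K \<subseteq> D" "\<And>x. x \<notin> K \<Longrightarrow> \<phi> x = 0" "\<And>S. smooth_on S \<phi>"
    using test_functionsD[OF assms] by blast
  have "frechet_derivative \<phi> (at x) v = 0" if "x \<notin> K" for x
  proof -
    have "(\<phi> has_derivative (\<lambda>h. 0)) (at x)"
      by (rule has_derivative_transform_within_open[of "\<lambda>x. 0" _ _ _ "- K"])
        (use that K in \<open>auto simp: compact_imp_closed open_Compl\<close>)
    then show ?thesis by (simp flip: frechet_derivative_at)
  qed
  then show ?thesis
    using K by (intro test_functionsI[of _ K] smooth_on_frechet) auto
qed

lemma test_functions_linear:
  assumes "\<phi> \<in> test_functions D" "bounded_linear L"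
  shows "(\<lambda>x. L (\<phi> x)) \<in> test_functions D"
proof -
  obtain K where K: "compact K" "K \<subseteq> D" "\<And>x. x \<notin> K \<Longrightarrow> \<phi> x = 0" "\<And>S. smooth_on S \<phi>"
    using test_functionsD[OF assms(1)] by blast
  show ?thesis
  proof (rule test_functionsI[of _ K])
    show "smooth_on UNIV (\<lambda>x. L (\<phi> x))" by (rule smooth_on_linear[OF open_UNIV assms(2) K(4)])
    show "{x. L (\<phi> x) \<noteq> 0} \<subseteq> K" using K(3) linear_simps(3)[OF assms(2)] by (metis (mono_tags, lifting) mem_Collect_eq subsetI)
  qed (fact K)+
qed

lemma test_functions_diff:
  assumes "\<phi> \<in> test_functions D" "\<psi> \<in> test_functions D"
  shows "(\<lambda>x. \<phi> x - \<psi> x) \<in> test_functions D"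
proof -
  obtain K where "compact K" "K \<subseteq> D" "\<And>x. x \<notin> K \<Longrightarrow> \<phi> x = 0" "\<And>S. smooth_on S \<phi>"
    using test_functionsD[OF assms(1)] by blast
  moreover obtain L where "compact L" "L \<subseteq> D" "\<And>x. x \<notin> L \<Longrightarrow> \<psi> x = 0" "\<And>S. smooth_on S \<psi>"
    using test_functionsD[OF assms(2)] by blast
  ultimately show ?thesis
    by (intro test_functionsI[of _ "K \<union> L"] smooth_on_diff) (auto intro!: compact_Un, metis)
qed

lemma test_functions_vec:
  fixes \<phi> :: "'a::real_normed_vector \<Rightarrow> real^'n"
  assumes "\<And>i. (\<lambda>x. \<phi> x $ i) \<in> test_functions D"
  shows "\<phi> \<in> test_functions D"
proof -
  have "\<forall>i. \<exists>K. compact K \<and> K \<subseteq> D \<and> (\<forall>x. x \<notin> K \<longrightarrow> \<phi> x $ i = 0)"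
    using assms test_functionsD by metis
  then obtain K where K: "\<And>i. compact (K i) \<and> K i \<subseteq> D \<and> (\<forall>x. x \<notin> K i \<longrightarrow> \<phi> x $ i = 0)"
    by metis
  show ?thesis
  proof (rule test_functionsI)
    show "smooth_on UNIV \<phi>"
      using assms by (intro smooth_on_vec) (auto simp: test_functions_def)
    show "{x. \<phi> x \<noteq> 0} \<subseteq> (\<Union>i. K i)" using K by (auto simp: vec_eq_iff)
    show "compact (\<Union>i. K i)" "(\<Union>i. K i) \<subseteq> D" using K by (auto intro: compact_UN)
  qed
qed

lemma test_functions_bounded:
  assumes "\<phi> \<in> test_functions D"
  obtains B where "\<And>x. norm (\<phi> x) \<le> B"
proof -
  obtain K where K: "compact K" "K \<subseteq> D" "\<And>x. x \<notin> K \<Longrightarrow> \<phi> x = 0" "\<And>S. smooth_on S \<phi>"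
    using test_functionsD[OF assms] by blast
  have "bounded (\<phi> ` K)"
    by (intro compact_imp_bounded compact_continuous_image smooth_on_continuous_on K)
  then obtain B where "\<forall>x\<in>K. norm (\<phi> x) \<le> B" by (auto simp: bounded_iff)
  then have "norm (\<phi> x) \<le> max B 0" for x
    using K(3)[of x] by (cases "x \<in> K") auto
  then show ?thesis using that by blast
qed

text \<open>Heine-Cantor applies on a ball whose radius exceeds that of a ball around the support by
  1. Two points at distance less than 1 that are not both in the larger ball both lie off the
  support.\<close>

lemma test_functions_uniformly_continuous:
  fixes \<phi> :: "'a::euclidean_space \<Rightarrow> 'b::real_normed_vector"
  assumes "\<phi> \<in> test_functions D" "e > 0"
  obtains d where "d > 0" "\<And>x y. dist x y < d \<Longrightarrow> dist (\<phi> x) (\<phi> y) < e"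
proof -
  obtain K where K: "compact K" "K \<subseteq> D" "\<And>x. x \<notin> K \<Longrightarrow> \<phi> x = 0" "\<And>S. smooth_on S \<phi>"
    using test_functionsD[OF assms(1)] by blast
  obtain R where R: "K \<subseteq> ball 0 R"
    using compact_imp_bounded[OF K(1)] bounded_subset_ballD by blast
  have "uniformly_continuous_on (cball 0 (R + 1)) \<phi>"
    by (intro compact_uniformly_continuous smooth_on_continuous_on K) simp
  then obtain d where d: "d > 0"
    "\<And>x y. x \<in> cball 0 (R + 1) \<Longrightarrow> y \<in> cball 0 (R + 1) \<Longrightarrow> dist x y < d \<Longrightarrow> dist (\<phi> x) (\<phi> y) < e"
    using assms(2) unfolding uniformly_continuous_on_def by (metis dist_commute)
  have "dist (\<phi> x) (\<phi> y) < e" if xy: "dist x y < min d 1" for x y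
  proof (cases "x \<in> cball 0 (R + 1) \<and> y \<in> cball 0 (R + 1)")
    case True
    then show ?thesis using d xy by auto
  next
    case False
    have "\<bar>norm x - norm y\<bar> < 1" using xy norm_triangle_ineq3[of x y] by (simp add: dist_norm)
    then have "x \<notin> K" "y \<notin> K" using R False by auto
    then show ?thesis using K assms(2) by simp
  qed
  then show ?thesis using d(1) that[of "min d 1"] by auto
qed

text \<open>The remainder bound has to be uniform in the base point, because it will be integrated
  against a field. It holds because the derivatives along basis vectors are again test functions,
  hence uniformly continuous, which controls the variation of the full derivative in operator
  norm.\<close>

lemma test_functions_uniform_derivative:
  fixes \<phi> :: "'a::euclidean_space \<Rightarrow> real"
  assumes "\<phi> \<in> test_functions D" "e > 0"
  obtains d where "d > 0"
    "\<And>x h. norm h < d \<Longrightarrow> \<bar>\<phi> (x + h) - \<phi> x - frechet_derivative \<phi> (at x) h\<bar> \<le> e * norm h"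
proof -
  let ?D = "\<lambda>x. frechet_derivative \<phi> (at x)"
  \<comment> \<open>One share of \<open>e\<close> for each basis vector in the expansion of the
    direction.\<close>
  define e' where "e' = e / DIM('a)"
  have e': "e' > 0" using assms(2) by (simp add: e'_def)
  have "\<forall>b. \<exists>d>0. \<forall>x y. dist x y < d \<longrightarrow> dist (?D x b) (?D y b) < e'"
    using test_functions_uniformly_continuous[OF test_functions_frechet[OF assms(1)] e'] by metis
  then obtain d where d: "\<And>b. d b > 0" "\<And>b x y. dist x y < d b \<Longrightarrow> dist (?D x b) (?D y b) < e'"
    by metis
  define m where "m = Min (d ` Basis)"
  have m: "m > 0" "\<And>b. b \<in> Basis \<Longrightarrow> m \<le> d b"
    using d(1) by (auto simp: m_def)
  have der: "(\<phi> has_derivative ?D x) (at x)" for x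
    using test_functionsD[OF assms(1)] smooth_on_has_derivative by (metis UNIV_I)
  have lin: "linear (?D x)" for x using der has_derivative_linear by blast
  have on: "onorm (\<lambda>v. ?D x v - ?D y v) \<le> e" if "dist x y < m" for x y
  proof (rule onorm_le)
    fix v
    have "?D x v - ?D y v = (\<Sum>b\<in>Basis. (v \<bullet> b) * (?D x b - ?D y b))"
    proof -
      have "?D x v = (\<Sum>b\<in>Basis. (v \<bullet> b) * ?D x b)" for x
        using linear_sum[OF lin[of x], of "\<lambda>b. (v \<bullet> b) *\<^sub>R b" Basis]
        by (simp add: euclidean_representation linear_cmul[OF lin])
      then show ?thesis by (simp add: right_diff_distrib sum_subtractf)
    qed
    also have "norm \<dots> \<le> (\<Sum>b\<in>(Basis::'a set). norm v * e')"
    proof (rule sum_norm_le)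
      fix b :: 'a assume b: "b \<in> Basis"
      have "\<bar>?D x b - ?D y b\<bar> \<le> e'"
        using d(2)[of x y b] m(2)[OF b] that by (simp add: dist_real_def)
      then show "norm ((v \<bullet> b) * (?D x b - ?D y b)) \<le> norm v * e'"
        using Basis_le_norm[OF b, of v] by (simp add: abs_mult mult_mono)
    qed
    also have "\<dots> = e * norm v" by (simp add: e'_def)
    finally show "norm (?D x v - ?D y v) \<le> e * norm v" .
  qed
  show ?thesis
  proof (rule that[OF m(1)])
    fix x h :: 'a assume h: "norm h < m"
    have "norm (\<phi> (x + h) - \<phi> x - ?D x (x + h - x)) \<le> norm (x + h - x) * e"
    proof (rule differentiable_bound_linearization[where S="ball x m"])
      show "\<And>t. t \<in> {0..1} \<Longrightarrow> x + t *\<^sub>R (x + h - x) \<in> ball x m"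
        using h by (auto simp: dist_norm intro: le_less_trans[OF mult_left_le_one_le])
      show "\<And>z. z \<in> ball x m \<Longrightarrow> (\<phi> has_derivative ?D z) (at z within ball x m)"
        using der has_derivative_at_withinI by blast
      show "\<And>z. z \<in> ball x m \<Longrightarrow> onorm (?D z - ?D x) \<le> e"
        using on by (simp add: fun_diff_def dist_commute)
    qed (use m in auto)
    then show "\<bar>\<phi> (x + h) - \<phi> x - ?D x h\<bar> \<le> e * norm h"
      by (simp add: mult.commute)
  qed
qed


section \<open>Convolution with a test function\<close>

text \<open>The kernel has argument \<open>z - a\<close> rather than \<open>a - z\<close>, matching
  the substitution \<open>z = a + s *\<^sub>R y\<close>. Differentiation in \<open>a\<close>
  therefore costs a minus sign, which cancels the one in the weak gradient and the weak
  divergence.\<close>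

definition mollify :: "('a::euclidean_space \<Rightarrow> real) \<Rightarrow> ('a \<Rightarrow> 'b::euclidean_space) \<Rightarrow> 'a \<Rightarrow> 'b" where
  "mollify \<phi> f a = (LINT z|lebesgue. \<phi> (z - a) *\<^sub>R f z)"

text \<open>A test function is bounded, so the product is dominated by a multiple of the norm of
  \<open>f\<close>. A general product covers both a scalar kernel times a vector field and a scalar
  field times the gradient of a test function.\<close>

lemma integrable_test_function_bilinear:
  fixes f :: "'a::euclidean_space \<Rightarrow> 'b::euclidean_space" and \<phi> :: "'a \<Rightarrow> 'c::euclidean_space"
    and B :: "'c \<Rightarrow> 'b \<Rightarrow> 'd::euclidean_space"
  assumes "bounded_bilinear B" "\<phi> \<in> test_functions D" "integrable lebesgue f"
  shows "integrable lebesgue (\<lambda>z. B (\<phi> (z - a)) (f z))"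
proof -
  obtain C where C: "\<And>x. norm (\<phi> x) \<le> C"
    using test_functions_bounded[OF assms(2)] by blast
  obtain L where L: "L > 0" "\<And>x y. norm (B x y) \<le> norm x * norm y * L"
    using bounded_bilinear.pos_bounded[OF assms(1)] by blast
  have cont: "continuous_on UNIV \<phi>"
    using test_functionsD[OF assms(2)] smooth_on_continuous_on by metis
  have "continuous_on UNIV (\<lambda>z. \<phi> (z - a))"
    by (intro continuous_on_compose2[OF cont] continuous_intros) auto
  then have meas: "(\<lambda>z. \<phi> (z - a)) \<in> borel_measurable lebesgue"
    by (intro measurable_completion) (simp add: borel_measurable_continuous_onI)
  have contB: "continuous_on UNIV (\<lambda>p. B (fst p) (snd p))"
    by (intro bounded_bilinear.continuous_on[OF assms(1)] continuous_intros)
  show ?thesis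
  proof (rule Bochner_Integration.integrable_bound[OF integrable_mult_right[OF integrable_norm[OF assms(3)], of "C * L"]])
    show "(\<lambda>z. B (\<phi> (z - a)) (f z)) \<in> borel_measurable lebesgue"
      by (rule borel_measurable_continuous_Pair[OF meas borel_measurable_integrable[OF assms(3)] contB])
    show "AE z in lebesgue. norm (B (\<phi> (z - a)) (f z)) \<le> norm (C * L * norm (f z))"
    proof (intro always_eventually allI)
      fix z
      have "norm (B (\<phi> (z - a)) (f z)) \<le> norm (\<phi> (z - a)) * norm (f z) * L" by (rule L)
      also have "\<dots> \<le> C * norm (f z) * L"
        using C L(1) by (intro mult_right_mono) auto
      finally show "norm (B (\<phi> (z - a)) (f z)) \<le> norm (C * L * norm (f z))"
        by (simp add: mult_ac)
    qed
  qed
qed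

lemmas integrable_test_function_scaleR = integrable_test_function_bilinear[OF bounded_bilinear_scaleR]

text \<open>The Taylor remainder of the kernel is small relative to the increment uniformly in the
  integration variable, so its integral against the integrable \<open>f\<close> is small relative to
  the increment too.\<close>

lemma mollify_has_derivative:
  fixes f :: "'a::euclidean_space \<Rightarrow> 'b::euclidean_space" and \<phi> :: "'a \<Rightarrow> real"
  assumes "\<phi> \<in> test_functions D" "integrable lebesgue f"
  shows "(mollify \<phi> f has_derivative (\<lambda>h. - mollify (\<lambda>y. frechet_derivative \<phi> (at y) h) f a)) (at a)"
proof -
  let ?D = "\<lambda>x. frechet_derivative \<phi> (at x)"
  have der: "(\<phi> has_derivative ?D x) (at x)" for x
    using test_functionsD[OF assms(1)] smooth_on_has_derivative by (metis UNIV_I)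
  have lin: "linear (?D x)" for x using der has_derivative_linear by blast
  note int = integrable_test_function_scaleR[OF assms]
  note int' = integrable_test_function_scaleR[OF test_functions_frechet[OF assms(1)] assms(2)]
  have "linear (\<lambda>h. - mollify (\<lambda>y. ?D y h) f a)"
    by (rule linearI)
      (simp_all add: mollify_def linear_add[OF lin] linear_cmul[OF lin] scaleR_add_left int'
        flip: scaleR_scaleR)
  then have bl: "bounded_linear (\<lambda>h. - mollify (\<lambda>y. ?D y h) f a)"
    by (simp add: linear_conv_bounded_linear)
  define M where "M = (LINT z|lebesgue. norm (f z))"
  have M: "M \<ge> 0" by (simp add: M_def)
  have "\<exists>d>0. \<forall>y. norm (y - a) < d \<longrightarrow>
      norm (mollify \<phi> f y - mollify \<phi> f a - (- mollify (\<lambda>z. ?D z (y - a)) f a)) \<le> e * norm (y - a)"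
    if e: "e > 0" for e
  proof -
    \<comment> \<open>\<open>M + 1\<close> instead of \<open>M\<close> allows for a field with zero
      integral norm; the integrated bound then carries the harmless factor
      \<open>M / (M + 1)\<close>.\<close>
    have "e / (M + 1) > 0" using e M by simp
    then obtain d where d: "d > 0"
      "\<And>x h. norm h < d \<Longrightarrow> \<bar>\<phi> (x + h) - \<phi> x - ?D x h\<bar> \<le> e / (M + 1) * norm h"
      using test_functions_uniform_derivative[OF assms(1)] by blast
    have "norm (mollify \<phi> f y - mollify \<phi> f a - (- mollify (\<lambda>z. ?D z (y - a)) f a)) \<le> e * norm (y - a)"
      if y: "norm (y - a) < d" for y
    proof -
      have eq: "mollify \<phi> f y - mollify \<phi> f a - (- mollify (\<lambda>z. ?D z (y - a)) f a)
          = (LINT z|lebesgue. (\<phi> (z - y) - \<phi> (z - a) - ?D (z - a) (a - y)) *\<^sub>R f z)"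
      proof -
        have "?D (z - a) (a - y) = - ?D (z - a) (y - a)" for z
          by (metis lin linear_neg minus_diff_eq)
        then show ?thesis
          by (simp add: mollify_def scaleR_left.diff scaleR_left.add int int' Bochner_Integration.integral_diff
              Bochner_Integration.integral_add)
      qed
      have "norm (LINT z|lebesgue. (\<phi> (z - y) - \<phi> (z - a) - ?D (z - a) (a - y)) *\<^sub>R f z)
          \<le> (LINT z|lebesgue. (e / (M + 1) * norm (y - a)) * norm (f z))"
      proof (rule Bochner_Integration.integral_norm_bound_integral)
        show "integrable lebesgue (\<lambda>z. (\<phi> (z - y) - \<phi> (z - a) - ?D (z - a) (a - y)) *\<^sub>R f z)"
          unfolding scaleR_left.diff by (intro Bochner_Integration.integrable_diff int int')
        show "integrable lebesgue (\<lambda>z. e / (M + 1) * norm (y - a) * norm (f z))"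
          using assms(2) by simp
        fix z
        have "\<bar>\<phi> (z - a + (a - y)) - \<phi> (z - a) - ?D (z - a) (a - y)\<bar> \<le> e / (M + 1) * norm (a - y)"
          using y by (intro d) (simp add: norm_minus_commute)
        then have "\<bar>\<phi> (z - y) - \<phi> (z - a) - ?D (z - a) (a - y)\<bar> \<le> e / (M + 1) * norm (y - a)"
          by (simp add: norm_minus_commute)
        from mult_right_mono[OF this norm_ge_zero[of "f z"]]
        show "norm ((\<phi> (z - y) - \<phi> (z - a) - ?D (z - a) (a - y)) *\<^sub>R f z)
            \<le> e / (M + 1) * norm (y - a) * norm (f z)"
          by simp
      qed
      also have "\<dots> = e * norm (y - a) * (M / (M + 1))" by (simp add: M_def)
      also have "\<dots> \<le> e * norm (y - a) * 1"
        using M e by (intro mult_left_mono) (auto simp: field_simps)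
      finally show ?thesis unfolding eq by simp
    qed
    then show ?thesis using d(1) by blast
  qed
  then show ?thesis using bl unfolding has_derivative_at_alt by blast
qed

text \<open>Up to sign, a derivative of a mollification is a mollification with a differentiated
  kernel. The induction therefore varies the kernel and leaves the field alone.\<close>

lemma smooth_on_mollify:
  fixes f :: "'a::euclidean_space \<Rightarrow> 'b::euclidean_space" and \<phi> :: "'a \<Rightarrow> real"
  assumes "\<phi> \<in> test_functions D" "integrable lebesgue f"
  shows "smooth_on UNIV (mollify \<phi> f)"
proof -
  have "higher_differentiable_on k UNIV (mollify \<phi> f)" for k
    using assms(1)
  proof (induction k arbitrary: \<phi>)
    case 0
    then show ?case
      using has_derivative_continuous[OF mollify_has_derivative[OF 0 assms(2)]]
      by (simp add: continuous_at_imp_continuous_on)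
  next
    case (Suc k)
    show ?case
      by (rule higher_differentiable_on_SucI[OF _ mollify_has_derivative[OF Suc.prems assms(2)]])
        (intro open_UNIV higher_differentiable_on_linear[OF _ bounded_linear_minus[OF bounded_linear_ident]]
          Suc.IH test_functions_frechet Suc.prems)+
  qed
  then show ?thesis by (simp add: smooth_on_def)
qed

lemma frechet_derivative_mollify:
  fixes f :: "'a::euclidean_space \<Rightarrow> 'b::euclidean_space" and \<phi> :: "'a \<Rightarrow> real"
  assumes "\<phi> \<in> test_functions D" "integrable lebesgue f"
  shows "frechet_derivative (mollify \<phi> f) (at a) v
    = - mollify (\<lambda>y. frechet_derivative \<phi> (at y) v) f a"
  by (rule fun_cong[OF frechet_derivative_at[OF mollify_has_derivative[OF assms]], symmetric])


lemma mollify_bounded_linear: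
  fixes f :: "'a::euclidean_space \<Rightarrow> 'b::euclidean_space" and L :: "'b \<Rightarrow> 'c::euclidean_space"
  assumes "\<phi> \<in> test_functions D" "integrable lebesgue f" "bounded_linear L"
  shows "mollify \<phi> (\<lambda>z. L (f z)) a = L (mollify \<phi> f a)"
  unfolding mollify_def
  using integral_bounded_linear[OF assms(3) integrable_test_function_scaleR[OF assms(1,2), of a]]
  by (simp add: linear_cmul[OF bounded_linear.linear[OF assms(3)]])

lemma test_functions_translate:
  fixes \<phi> :: "'a::euclidean_space \<Rightarrow> 'b::real_normed_vector"
  assumes "\<phi> \<in> test_functions (cball 0 s)" "cball a s \<subseteq> D"
  shows "(\<lambda>z. \<phi> (z - a)) \<in> test_functions D"
proof (rule test_functionsI)
  obtain K where K: "K \<subseteq> cball 0 s" "\<And>x. x \<notin> K \<Longrightarrow> \<phi> x = 0" "\<And>S. smooth_on S \<phi>"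
    using test_functionsD[OF assms(1)] by metis
  show "smooth_on UNIV (\<lambda>z. \<phi> (z - a))"
    by (intro smooth_on_compose[OF _ _ _ K(3)[of UNIV]] smooth_on_intros) auto
  show "{z. \<phi> (z - a) \<noteq> 0} \<subseteq> cball a s"
    using K(1,2) by (force simp: dist_norm norm_minus_commute)
qed (use assms in auto)

lemma frechet_derivative_translate:
  fixes \<phi> :: "'a::euclidean_space \<Rightarrow> 'b::real_normed_vector"
  assumes "\<phi> \<in> test_functions D"
  shows "frechet_derivative (\<lambda>z. \<phi> (z - a)) (at z) = frechet_derivative \<phi> (at (z - a))"
proof -
  have "((\<lambda>z. z - a) has_derivative (\<lambda>h. h)) (at z)"
    by (auto intro!: derivative_eq_intros)
  moreover have "(\<phi> has_derivative frechet_derivative \<phi> (at (z - a))) (at (z - a))"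
    using test_functionsD[OF assms] smooth_on_has_derivative by (metis UNIV_I)
  ultimately have "((\<lambda>z. \<phi> (z - a)) has_derivative frechet_derivative \<phi> (at (z - a))) (at z)"
    by (rule has_derivative_compose)
  then show ?thesis by (rule frechet_derivative_at[symmetric])
qed


section \<open>The mollification operators as convolutions\<close>

text \<open>Division by \<open>s ^ DIM('a)\<close> is the volume factor of the dilation, so the
  total mass of the kernel is preserved.\<close>

definition scaled_kernel :: "real \<Rightarrow> 'a::euclidean_space \<Rightarrow> real" where
  "scaled_kernel s y = kernel (y /\<^sub>R s) / s ^ DIM('a)"

lemma kernel_eq_0: "norm y \<ge> 1 \<Longrightarrow> kernel y = 0"
  by (simp add: kernel_def bump_def)

lemma scaled_kernel_test_function:
  assumes "s > 0"
  shows "(scaled_kernel s :: 'a::euclidean_space \<Rightarrow> real) \<in> test_functions (cball 0 s)"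
proof (rule test_functionsI)
  have "smooth_on UNIV (\<lambda>y::'a. bump (y /\<^sub>R s) * (1 / (LINT z|lebesgue. bump (z::'a)) / s ^ DIM('a)))"
    by (intro smooth_on_mult smooth_on_const smooth_on_compose[OF _ _ _ smooth_on_bump]
        smooth_on_linear[OF _ bounded_linear_scaleR_right] smooth_on_ident) auto
  then show "smooth_on UNIV (scaled_kernel s :: 'a \<Rightarrow> real)"
    by (simp add: scaled_kernel_def[abs_def] kernel_def)
  show "{y. scaled_kernel s y \<noteq> 0} \<subseteq> cball (0::'a) s"
  proof safe
    fix y :: 'a assume "scaled_kernel s y \<noteq> 0"
    then have "\<not> norm (y /\<^sub>R s) \<ge> 1" using kernel_eq_0 by (force simp: scaled_kernel_def)
    then show "y \<in> cball 0 s" using assms by (simp add: divide_simps split: if_splits)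
  qed
qed auto

text \<open>Representatives carry arbitrary values outside \<open>D\<close>; the indicator removes
  them, so that every integral can be taken over the whole space.\<close>

definition zero_ext :: "'a set \<Rightarrow> ('a \<Rightarrow> 'b::real_vector) \<Rightarrow> 'a \<Rightarrow> 'b" where
  "zero_ext D f z = indicator D z *\<^sub>R f z"

lemma integral_ball_kernel:
  fixes f :: "'a::euclidean_space \<Rightarrow> 'b::euclidean_space"
  assumes "s > 0" "integrable lebesgue (zero_ext D f)" "ball a s \<subseteq> D"
  shows "(LINT y:ball 0 1|lebesgue. kernel y *\<^sub>R f (a + s *\<^sub>R y))
    = mollify (scaled_kernel s) (zero_ext D f) a"
proof -
  define T where "T = (\<lambda>y::'a. a + s *\<^sub>R y)"
  define g where "g = (\<lambda>z. scaled_kernel s (z - a) *\<^sub>R zero_ext D f z)"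
  \<comment> \<open>The affine change of variables for the Lebesgue measure is stated with one
    factor per coordinate; equal factors make it a dilation.\<close>
  have T_eq: "(\<lambda>y. a + (\<Sum>b\<in>Basis. (s * (y \<bullet> b)) *\<^sub>R b)) = T"
    by (simp add: T_def euclidean_representation flip: scaleR_scaleR scaleR_sum_right)
  have meas: "g \<in> borel_measurable lebesgue"
    using integrable_test_function_scaleR[OF scaled_kernel_test_function[OF assms(1)] assms(2)]
    unfolding g_def by (rule borel_measurable_integrable)
  have T: "T \<in> lebesgue \<rightarrow>\<^sub>M lebesgue"
    using lebesgue_affine_measurable[of "\<lambda>_. s" a] assms(1) T_eq by simp
  \<comment> \<open>Inside the unit ball the image point lies in \<open>D\<close>, where the
    extension is \<open>f\<close>; elsewhere the kernel vanishes. This is why the open ball suffices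
    here.\<close>
  have gT: "s ^ DIM('a) *\<^sub>R g (T y) = indicator (ball 0 1) y *\<^sub>R (kernel y *\<^sub>R f (a + s *\<^sub>R y))" for y
  proof (cases "norm y < 1")
    case True
    then have "a + s *\<^sub>R y \<in> ball a s" using assms(1) by (simp add: dist_norm)
    then have "a + s *\<^sub>R y \<in> D" using assms(3) by blast
    then show ?thesis
      using assms(1) True by (simp add: g_def T_def scaled_kernel_def zero_ext_def)
  next
    case False
    then show ?thesis
      using assms(1) by (simp add: g_def T_def scaled_kernel_def kernel_eq_0)
  qed
  have "mollify (scaled_kernel s) (zero_ext D f) a = (LINT z|lebesgue. g z)"
    by (simp add: mollify_def g_def)
  also have "\<dots> = (LINT z|density (distr lebesgue lebesgue T) (\<lambda>_. ennreal (s ^ DIM('a))). g z)"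
    using lebesgue_affine_euclidean[of "\<lambda>_. s" a] assms(1) T_eq by simp
  also have "\<dots> = (LINT z|distr lebesgue lebesgue T. s ^ DIM('a) *\<^sub>R g z)"
    using meas assms(1) by (intro integral_density) auto
  also have "\<dots> = (LINT y|lebesgue. s ^ DIM('a) *\<^sub>R g (T y))"
    using meas T by (intro integral_distr) auto
  finally show ?thesis by (simp add: gT set_lebesgue_integral_def)
qed

lemma Kg_eq:
  assumes "\<delta> * r > 0" "integrable lebesgue (zero_ext D f)" "ball (shrink j \<delta> x) (\<delta> * r) \<subseteq> D"
  shows "Kg j r \<delta> f x = mollify (scaled_kernel (\<delta> * r)) (zero_ext D f) (shrink j \<delta> x)"
  using integral_ball_kernel[OF assms] by (simp add: Kg_def)

text \<open>In the operators for vector fields and in the last scalar one, the Jacobian factors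
  depend on \<open>x\<close> but not on the integration variable, so they form a linear map that
  leaves the integral.\<close>

lemma integral_ball_kernel_linear:
  fixes f :: "'a::euclidean_space \<Rightarrow> 'b::euclidean_space" and L :: "'b \<Rightarrow> 'c::euclidean_space"
  assumes "s > 0" "integrable lebesgue (zero_ext D f)" "ball a s \<subseteq> D" "bounded_linear L"
  shows "(LINT y:ball 0 1|lebesgue. kernel y *\<^sub>R L (f (a + s *\<^sub>R y)))
    = L (mollify (scaled_kernel s) (zero_ext D f) a)"
proof -
  have eq: "zero_ext D (\<lambda>z. L (f z)) = (\<lambda>z. L (zero_ext D f z))"
    by (simp add: zero_ext_def fun_eq_iff linear_simps[OF assms(4)])
  then have "integrable lebesgue (zero_ext D (\<lambda>z. L (f z)))"
    using integrable_bounded_linear[OF assms(4,2)] by simp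
  from integral_ball_kernel[OF assms(1) this assms(3)] show ?thesis
    by (simp add: eq mollify_bounded_linear[OF scaled_kernel_test_function[OF assms(1)] assms(2,4)])
qed

lemma Kc_eq:
  assumes "\<delta> * r > 0" "integrable lebesgue (zero_ext D g)" "ball (shrink j \<delta> x) (\<delta> * r) \<subseteq> D"
  shows "Kc j r \<delta> g x
    = transpose (Jac j \<delta> x) *v mollify (scaled_kernel (\<delta> * r)) (zero_ext D g) (shrink j \<delta> x)"
  unfolding Kc_def by (rule integral_ball_kernel_linear[OF assms matrix_vector_mul_bounded_linear])

lemma Kd_eq:
  assumes "\<delta> * r > 0" "integrable lebesgue (zero_ext D g)" "ball (shrink j \<delta> x) (\<delta> * r) \<subseteq> D"
  shows "Kd j r \<delta> g x = det (Jac j \<delta> x) *\<^sub>R (matrix_inv (Jac j \<delta> x) *v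
    mollify (scaled_kernel (\<delta> * r)) (zero_ext D g) (shrink j \<delta> x))"
  unfolding Kd_def scaleR_scaleR[of "kernel y" for y, symmetric]
  by (rule integral_ball_kernel_linear[OF assms bounded_linear_compose[OF bounded_linear_scaleR_right matrix_vector_mul_bounded_linear]])

lemma Kb_eq:
  assumes "\<delta> * r > 0" "integrable lebesgue (zero_ext D f)" "ball (shrink j \<delta> x) (\<delta> * r) \<subseteq> D"
  shows "Kb j r \<delta> f x
    = det (Jac j \<delta> x) * mollify (scaled_kernel (\<delta> * r)) (zero_ext D f) (shrink j \<delta> x)"
  using integral_ball_kernel_linear[OF assms bounded_linear_mult_right] by (simp add: Kb_def mult.assoc)

text \<open>A bounded \<open>D\<close> has finite measure, and \<open>t\<close> is at most
  \<open>1 + t powr p\<close> for nonnegative \<open>t\<close> and finite \<open>p \<ge> 1\<close>;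
  for \<open>p = \<infinity>\<close> a constant dominates. A single theory for integrable fields
  thus serves all exponents.\<close>

lemma Lp_integrable_zero_ext:
  fixes f :: "'a::euclidean_space \<Rightarrow> 'b::euclidean_space"
  assumes "f \<in> Lp p D" "open D" "bounded D" "1 \<le> p"
  shows "integrable lebesgue (zero_ext D f)"
proof -
  have meas: "zero_ext D f \<in> borel_measurable lebesgue"
    using assms(1) by (simp add: Lp_def set_borel_measurable_def zero_ext_def[abs_def])
  have D: "integrable lebesgue (\<lambda>x. indicator D x :: real)"
    using assms(2,3) by (simp add: lmeasurable_open flip: lmeasurable_iff_integrable)
  show ?thesis
  proof (cases "p = \<infinity>")
    case True
    then obtain C where "AE x in lebesgue. x \<in> D \<longrightarrow> norm (f x) \<le> C"
      using assms(1) by (auto simp: Lp_def)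
    then have "AE x in lebesgue. norm (zero_ext D f x) \<le> norm (C * indicator D x)"
      by eventually_elim (auto simp: zero_ext_def indicator_def)
    then show ?thesis
      by (intro Bochner_Integration.integrable_bound[OF integrable_mult_right[OF D] meas])
  next
    case False
    then have int: "integrable lebesgue (\<lambda>x. indicator D x *\<^sub>R norm (f x) powr enn2real p)"
      using assms(1) by (simp add: Lp_def set_integrable_def)
    have p: "1 \<le> enn2real p"
      using enn2real_mono[OF assms(4)] False by (simp add: less_top)
    have "norm (zero_ext D f x) \<le> norm (indicator D x + indicator D x *\<^sub>R norm (f x) powr enn2real p)" for x
    proof (cases "norm (f x) \<le> 1")
      case True
      then show ?thesis by (auto simp: zero_ext_def indicator_def add_increasing2)
    next
      case False
      then have "norm (f x) powr 1 \<le> norm (f x) powr enn2real p"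
        using p by (intro powr_mono) auto
      then show ?thesis using False by (auto simp: zero_ext_def indicator_def)
    qed
    then show ?thesis
      by (intro Bochner_Integration.integrable_bound[OF Bochner_Integration.integrable_add[OF D int] meas]) simp
  qed
qed


section \<open>Weak derivatives of mollified fields\<close>

definition pd :: "'n \<Rightarrow> (real^'n \<Rightarrow> real) \<Rightarrow> real^'n \<Rightarrow> real" where
  "pd i f x = frechet_derivative f (at x) (axis i 1)"

lemma smooth_on_pd: "smooth_on S f \<Longrightarrow> smooth_on S (pd i f)"
  unfolding pd_def[abs_def] by (rule smooth_on_frechet)

lemma test_functions_pd: "\<phi> \<in> test_functions D \<Longrightarrow> pd i \<phi> \<in> test_functions D"
  unfolding pd_def[abs_def] by (rule test_functions_frechet)

lemma grad_nth: "grad f x $ i = pd i f x"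
  by (simp add: grad_def pd_def)

lemma frechet_derivative_linear:
  assumes "f differentiable (at x)" "bounded_linear L"
  shows "frechet_derivative (\<lambda>x. L (f x)) (at x) = (\<lambda>h. L (frechet_derivative f (at x) h))"
proof -
  have "(f has_derivative frechet_derivative f (at x)) (at x)"
    using assms(1) by (simp add: frechet_derivative_works)
  from frechet_derivative_at[OF bounded_linear.has_derivative[OF assms(2) this]] show ?thesis by (rule sym)
qed

lemma jacobian_nth: "jacobian v (at x) $ i $ k = frechet_derivative v (at x) (axis k 1) $ i"
  by (simp add: jacobian_def matrix_def)

lemma jacobian_pd:
  assumes "v differentiable (at x)"
  shows "jacobian v (at x) $ i $ k = pd k (\<lambda>x. v x $ i) x"
  by (simp add: jacobian_nth pd_def frechet_derivative_linear[OF assms bounded_linear_vec_nth])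

lemma pd_translate: "\<phi> \<in> test_functions D \<Longrightarrow> pd i (\<lambda>z. \<phi> (z - a)) z = pd i \<phi> (z - a)"
  by (simp add: pd_def frechet_derivative_translate)

lemma jacobian_mollify:
  fixes f :: "real^'n \<Rightarrow> real^'m"
  assumes "\<phi> \<in> test_functions D" "integrable lebesgue f"
  shows "jacobian (mollify \<phi> f) (at a) $ i $ k = - (LINT z|lebesgue. pd k \<phi> (z - a) * f z $ i)"
proof -
  have "mollify (pd k \<phi>) f a $ i = (LINT z|lebesgue. pd k \<phi> (z - a) * f z $ i)"
    using mollify_bounded_linear[OF test_functions_pd[OF assms(1)] assms(2) bounded_linear_vec_nth, symmetric]
    by (simp add: mollify_def)
  then show ?thesis
    by (simp add: jacobian_nth frechet_derivative_mollify[OF assms] flip: pd_def)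
qed

text \<open>The weak gradient is defined by an identity between vector-valued integrals.
  Integrability of both integrands is what permits passing to a component under the
  integral.\<close>

lemma weak_grad_component:
  assumes "has_weak_grad D f h" "integrable lebesgue (zero_ext D f)" "integrable lebesgue (zero_ext D h)"
    "\<phi> \<in> test_functions D"
  shows "(LINT z|lebesgue. pd i \<phi> z * zero_ext D f z) = - (LINT z|lebesgue. \<phi> z * zero_ext D h z $ i)"
proof -
  have grad: "grad \<phi> \<in> test_functions D"
    by (rule test_functions_vec) (simp add: grad_nth test_functions_pd assms(4))
  have int1: "integrable lebesgue (\<lambda>z. zero_ext D f z *\<^sub>R grad \<phi> z)"
    using integrable_test_function_bilinear[OF bounded_bilinear.flip[OF bounded_bilinear_scaleR] grad assms(2), of 0]
    by simp
  have int2: "integrable lebesgue (\<lambda>z. \<phi> z *\<^sub>R zero_ext D h z)"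
    using integrable_test_function_scaleR[OF assms(4,3), of 0] by simp
  have "(LINT z|lebesgue. zero_ext D f z *\<^sub>R grad \<phi> z) = - (LINT z|lebesgue. \<phi> z *\<^sub>R zero_ext D h z)"
    using assms(1,4)
    by (simp add: has_weak_grad_def set_lebesgue_integral_def zero_ext_def mult.commute)
  then have "(LINT z|lebesgue. zero_ext D f z *\<^sub>R grad \<phi> z) $ i
      = - ((LINT z|lebesgue. \<phi> z *\<^sub>R zero_ext D h z) $ i)"
    by simp
  then show ?thesis
    using integral_bounded_linear[OF bounded_linear_vec_nth int1, of i]
      integral_bounded_linear[OF bounded_linear_vec_nth int2, of i]
    by (simp add: grad_nth mult.commute)
qed

text \<open>Differentiation in \<open>a\<close> falls on the kernel with a minus sign. As a function
  of \<open>z\<close> the translated kernel is a test function on \<open>D\<close>, so the weak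
  gradient moves the derivative to the field with a second minus sign.\<close>

lemma grad_mollify:
  assumes "has_weak_grad D f h" "integrable lebesgue (zero_ext D f)" "integrable lebesgue (zero_ext D h)"
    "\<phi> \<in> test_functions (cball 0 s)" "cball a s \<subseteq> D"
  shows "grad (mollify \<phi> (zero_ext D f)) a = mollify \<phi> (zero_ext D h) a"
proof -
  have "grad (mollify \<phi> (zero_ext D f)) a $ i = mollify \<phi> (zero_ext D h) a $ i" for i
  proof -
    have "grad (mollify \<phi> (zero_ext D f)) a $ i
        = - (LINT z|lebesgue. pd i (\<lambda>z. \<phi> (z - a)) z * zero_ext D f z)"
      using frechet_derivative_mollify[OF assms(4,2)]
      by (simp add: grad_nth pd_translate[OF assms(4)])
        (simp add: pd_def mollify_def)
    also have "\<dots> = (LINT z|lebesgue. \<phi> (z - a) * zero_ext D h z $ i)"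
      by (simp add: weak_grad_component[OF assms(1-3) test_functions_translate[OF assms(4,5)]])
    also have "\<dots> = mollify \<phi> (zero_ext D h) a $ i"
      using mollify_bounded_linear[OF assms(4,3) bounded_linear_vec_nth, of i]
      by (simp add: mollify_def)
    finally show ?thesis .
  qed
  then show ?thesis by (simp add: vec_eq_iff)
qed

lemma weak_curl_zero_ext:
  assumes "has_weak_curl D v w" "\<psi> \<in> test_functions D"
  shows "(LINT z|lebesgue. zero_ext D v z \<bullet> curl \<psi> z) = (LINT z|lebesgue. zero_ext D w z \<bullet> \<psi> z)"
  using assms by (simp add: has_weak_curl_def set_lebesgue_integral_def zero_ext_def)

lemma weak_div_zero_ext:
  assumes "has_weak_div D v w" "\<phi> \<in> test_functions D"
  shows "(LINT z|lebesgue. zero_ext D v z \<bullet> grad \<phi> z) = - (LINT z|lebesgue. zero_ext D w z * \<phi> z)"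
  using assms by (simp add: has_weak_div_def set_lebesgue_integral_def zero_ext_def mult.assoc)

lemma divergence_mollify:
  fixes v :: "real^'n \<Rightarrow> real^'n"
  assumes "has_weak_div D v w" "integrable lebesgue (zero_ext D v)" "integrable lebesgue (zero_ext D w)"
    "\<phi> \<in> test_functions (cball 0 s)" "cball a s \<subseteq> D"
  shows "divergence (mollify \<phi> (zero_ext D v)) a = mollify \<phi> (zero_ext D w) a"
proof -
  have int: "integrable lebesgue (\<lambda>z. pd i \<phi> (z - a) * zero_ext D v z $ i)" for i
    using integrable_bounded_linear[OF bounded_linear_vec_nth
        integrable_test_function_scaleR[OF test_functions_pd[OF assms(4)] assms(2)]]
    by simp
  have "divergence (mollify \<phi> (zero_ext D v)) a
      = - (\<Sum>i\<in>UNIV. (LINT z|lebesgue. pd i \<phi> (z - a) * zero_ext D v z $ i))"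
    by (simp add: divergence_def trace_def jacobian_mollify[OF assms(4,2)] sum_negf)
  also have "(\<Sum>i\<in>UNIV. (LINT z|lebesgue. pd i \<phi> (z - a) * zero_ext D v z $ i))
      = (LINT z|lebesgue. (\<Sum>i\<in>UNIV. pd i \<phi> (z - a) * zero_ext D v z $ i))"
    by (rule Bochner_Integration.integral_sum[symmetric]) (rule int)
  also have "\<dots> = (LINT z|lebesgue. zero_ext D v z \<bullet> grad (\<lambda>z. \<phi> (z - a)) z)"
    by (simp add: inner_vec_def grad_nth pd_translate[OF assms(4)] mult.commute)
  also have "\<dots> = - (LINT z|lebesgue. zero_ext D w z * \<phi> (z - a))"
    by (rule weak_div_zero_ext[OF assms(1) test_functions_translate[OF assms(4,5)]])
  finally show ?thesis by (simp add: mollify_def[of _ "zero_ext D w"] mult.commute)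
qed

lemma curl_nth:
  "curl v x $ 1 = jacobian v (at x) $ 3 $ 2 - jacobian v (at x) $ 2 $ 3"
  "curl v x $ 2 = jacobian v (at x) $ 1 $ 3 - jacobian v (at x) $ 3 $ 1"
  "curl v x $ 3 = jacobian v (at x) $ 2 $ 1 - jacobian v (at x) $ 1 $ 2"
  by (simp_all add: curl_def Let_def)

lemma jacobian_scaleR_const:
  fixes c :: "real^'m"
  assumes "\<phi> differentiable (at x)"
  shows "jacobian (\<lambda>z. \<phi> z *\<^sub>R c) (at x) $ i $ k = pd k \<phi> x * c $ i"
  by (simp add: jacobian_nth pd_def frechet_derivative_linear[OF assms bounded_linear_scaleR_left])

lemma curl_mollify:
  assumes "has_weak_curl D v w" "integrable lebesgue (zero_ext D v)" "integrable lebesgue (zero_ext D w)"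
    "\<phi> \<in> test_functions (cball 0 s)" "cball a s \<subseteq> D"
  shows "curl (mollify \<phi> (zero_ext D v)) a = mollify \<phi> (zero_ext D w) a"
proof -
  have int: "integrable lebesgue (\<lambda>z. pd k \<phi> (z - a) * zero_ext D v z $ i)" for i k
    using integrable_bounded_linear[OF bounded_linear_vec_nth
        integrable_test_function_scaleR[OF test_functions_pd[OF assms(4)] assms(2)]]
    by simp
  note tr = test_functions_translate[OF assms(4,5)]
  have diff: "(\<lambda>z. \<phi> (z - a)) differentiable (at z)" for z
    using test_functionsD[OF tr] smooth_on_has_derivative differentiableI by (metis UNIV_I)
  have jac: "jacobian (\<lambda>z. \<phi> (z - a) *\<^sub>R axis m 1) (at z) $ i $ k = pd k \<phi> (z - a) * (if i = m then 1 else 0)"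
    for m i k :: 3 and z
    by (simp add: jacobian_scaleR_const[OF diff] pd_translate[OF assms(4)] axis_def)
  \<comment> \<open>Testing with the kernel times a unit vector reads off one component of
    \<open>w\<close>. The curl of this test field contains exactly the two kernel derivatives in
    that component of the curl of the mollification; the minus sign from differentiating in
    \<open>a\<close> is absorbed by the antisymmetry of the curl.\<close>
  have "mollify \<phi> (zero_ext D w) a $ m
      = (LINT z|lebesgue. zero_ext D v z \<bullet> curl (\<lambda>z. \<phi> (z - a) *\<^sub>R axis m 1) z)" for m
  proof -
    have "(\<lambda>z. \<phi> (z - a) *\<^sub>R axis m (1::real)) \<in> test_functions D"
      by (rule test_functions_linear[OF tr bounded_linear_scaleR_left])
    from weak_curl_zero_ext[OF assms(1) this] show ?thesis
      using mollify_bounded_linear[OF assms(4,3) bounded_linear_vec_nth, of m a]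
      by (simp add: inner_axis mollify_def)
  qed
  then show ?thesis
    by (simp add: vec_eq_iff forall_3 curl_nth jacobian_mollify[OF assms(4,2)] inner_vec_def sum_3 jac
        right_diff_distrib Bochner_Integration.integral_diff int mult.commute[of "zero_ext D v _ $ _"])
qed


section \<open>Pullback of smooth fields\<close>

lemma smooth_on_differentiable: "smooth_on S f \<Longrightarrow> x \<in> S \<Longrightarrow> f differentiable (at x)"
  using smooth_on_has_derivative differentiableI by blast

lemma pd_eqI: "(f has_derivative f') (at x) \<Longrightarrow> pd i f x = f' (axis i 1)"
  unfolding pd_def by (simp only: frechet_derivative_at[symmetric])

lemma differentiable_has_frechet_derivative:
  "f differentiable (at x) \<Longrightarrow> (f has_derivative frechet_derivative f (at x)) (at x)"
  by (simp add: frechet_derivative_works)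

lemma pd_add:
  "f differentiable (at x) \<Longrightarrow> g differentiable (at x) \<Longrightarrow> pd i (\<lambda>x. f x + g x) x = pd i f x + pd i g x"
  using pd_eqI[OF has_derivative_add[OF differentiable_has_frechet_derivative differentiable_has_frechet_derivative]] by (simp add: pd_def)

lemma pd_diff:
  "f differentiable (at x) \<Longrightarrow> g differentiable (at x) \<Longrightarrow> pd i (\<lambda>x. f x - g x) x = pd i f x - pd i g x"
  using pd_eqI[OF has_derivative_diff[OF differentiable_has_frechet_derivative differentiable_has_frechet_derivative]] by (simp add: pd_def)

lemma pd_mult:
  "f differentiable (at x) \<Longrightarrow> g differentiable (at x)
    \<Longrightarrow> pd i (\<lambda>x. f x * g x) x = f x * pd i g x + pd i f x * g x"
  using pd_eqI[OF has_derivative_mult[OF differentiable_has_frechet_derivative differentiable_has_frechet_derivative]] by (simp add: pd_def)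

lemma pd_cong:
  assumes "open S" "x \<in> S" "f differentiable (at x)" "\<And>x. x \<in> S \<Longrightarrow> f x = g x"
  shows "pd i f x = pd i g x"
  unfolding pd_def using frechet_derivative_transform_within_open[OF assms(3,1,2,4)] by simp

lemma pd_commute: "open S \<Longrightarrow> smooth_on S f \<Longrightarrow> x \<in> S \<Longrightarrow> pd i (pd k f) x = pd k (pd i f) x"
  unfolding pd_def[abs_def] by (rule frechet_derivative_commute)

lemma pd_compose:
  fixes \<phi> :: "real^'n \<Rightarrow> real^'n"
  assumes "\<phi> differentiable (at x)" "f differentiable (at (\<phi> x))"
  shows "pd k (\<lambda>x. f (\<phi> x)) x = (\<Sum>l\<in>UNIV. pd l f (\<phi> x) * pd k (\<lambda>x. \<phi> x $ l) x)"
proof -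
  let ?v = "frechet_derivative \<phi> (at x) (axis k 1)"
  have lin: "linear (frechet_derivative f (at (\<phi> x)))"
    using differentiable_has_frechet_derivative[OF assms(2)] by (rule has_derivative_linear)
  have "pd k (\<lambda>x. f (\<phi> x)) x = frechet_derivative f (at (\<phi> x)) ?v"
    by (rule pd_eqI[OF has_derivative_compose[OF differentiable_has_frechet_derivative[OF assms(1)] differentiable_has_frechet_derivative[OF assms(2)]]])
  also have "?v = (\<Sum>l\<in>UNIV. ?v $ l *\<^sub>R axis l 1)"
    by (simp add: basis_expansion flip: scalar_mult_eq_scaleR)
  also have "frechet_derivative f (at (\<phi> x)) \<dots> = (\<Sum>l\<in>UNIV. ?v $ l * pd l f (\<phi> x))"
    by (simp add: linear_sum[OF lin] linear_cmul[OF lin] pd_def)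
  finally show ?thesis
    by (simp add: mult.commute pd_def frechet_derivative_linear[OF assms(1) bounded_linear_vec_nth])
qed

section \<open>Smoothness of the classical operators and the vanishing of their successive
  compositions\<close>

lemma smooth_on_jacobian_nth:
  "open S \<Longrightarrow> smooth_on S v \<Longrightarrow> smooth_on S (\<lambda>x. jacobian v (at x) $ i $ k)"
  by (simp add: jacobian_nth smooth_on_nth smooth_on_frechet)

lemma smooth_on_det_jacobian:
  fixes v :: "real^3 \<Rightarrow> real^3"
  shows "open S \<Longrightarrow> smooth_on S v \<Longrightarrow> smooth_on S (\<lambda>x. det (jacobian v (at x)))"
  by (simp add: det_3 smooth_on_intros smooth_on_jacobian_nth)

lemma smooth_on_grad: "open S \<Longrightarrow> smooth_on S f \<Longrightarrow> smooth_on S (grad f)"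
  by (rule smooth_on_vec) (simp_all add: grad_nth smooth_on_pd)

lemma smooth_on_curl: "open S \<Longrightarrow> smooth_on S v \<Longrightarrow> smooth_on S (curl v)"
proof (rule smooth_on_vec)
  fix i :: 3
  show "open S \<Longrightarrow> smooth_on S v \<Longrightarrow> smooth_on S (\<lambda>x. curl v x $ i)"
    using exhaust_3[of i]
    by (auto simp: curl_nth intro!: smooth_on_diff smooth_on_jacobian_nth)
qed

lemma smooth_on_divergence: "open S \<Longrightarrow> smooth_on S v \<Longrightarrow> smooth_on S (divergence v)"
  unfolding divergence_def[abs_def] trace_def by (intro smooth_on_sum smooth_on_jacobian_nth)

lemma jacobian_pd_smooth: "smooth_on S v \<Longrightarrow> x \<in> S \<Longrightarrow> jacobian v (at x) $ i $ k = pd k (\<lambda>x. v x $ i) x"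
  by (rule jacobian_pd[OF smooth_on_differentiable])

lemma curl_grad:
  assumes "open S" "smooth_on S u" "x \<in> S"
  shows "curl (grad u) x = 0"
proof -
  have "jacobian (grad u) (at x) $ i $ k = pd k (pd i u) x" for i k
    by (simp add: jacobian_pd_smooth[OF smooth_on_grad[OF assms(1,2)] assms(3)] grad_nth)
  then show ?thesis
    using pd_commute[OF assms] by (simp add: vec_eq_iff forall_3 curl_nth)
qed

lemma divergence_curl:
  assumes "open S" "smooth_on S v" "x \<in> S"
  shows "divergence (curl v) x = 0"
proof -
  let ?v = "\<lambda>i x. v x $ i"
  have sm: "smooth_on S (?v i)" "smooth_on S (pd k (?v i))" for i k
    using assms(1,2) by (simp_all add: smooth_on_nth smooth_on_pd)
  note df = smooth_on_differentiable[OF sm(2) assms(3)]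
  \<comment> \<open>Jacobian entries are known to be partial derivatives only on \<open>S\<close>,
    so they are exchanged under a further derivative by locality on the open set. The indices stay
    free to serve all three components.\<close>
  have "pd m (\<lambda>x. curl v x $ n) x = pd m (pd k (?v i)) x - pd m (pd l (?v h)) x"
    if "\<And>x. curl v x $ n = jacobian v (at x) $ i $ k - jacobian v (at x) $ h $ l" for m n i k h l
  proof -
    have "pd m (\<lambda>x. curl v x $ n) x = pd m (\<lambda>x. pd k (?v i) x - pd l (?v h) x) x"
      using jacobian_pd_smooth[OF assms(2)]
      by (intro pd_cong[OF assms(1,3)] smooth_on_differentiable[OF smooth_on_nth assms(3)]
          smooth_on_curl assms(1,2)) (simp add: that)
    then show ?thesis by (simp add: pd_diff df)
  qed
  note this[OF curl_nth(1)] this[OF curl_nth(2)] this[OF curl_nth(3)]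
  then show ?thesis
    by (simp add: divergence_def trace_def sum_3 jacobian_pd_smooth[OF smooth_on_curl[OF assms(1,2)] assms(3)]
        pd_commute[OF assms(1) sm(1) assms(3), of 2 1] pd_commute[OF assms(1) sm(1) assms(3), of 3 1]
        pd_commute[OF assms(1) sm(1) assms(3), of 3 2])
qed

text \<open>The transposed cofactor matrix, written out so that its entries are visibly polynomials
  and differentiate by the product rule.\<close>

definition adjugate3 :: "real^3^3 \<Rightarrow> real^3^3" where
  "adjugate3 A = vector [
     vector [A$2$2 * A$3$3 - A$2$3 * A$3$2, A$1$3 * A$3$2 - A$1$2 * A$3$3, A$1$2 * A$2$3 - A$1$3 * A$2$2],
     vector [A$2$3 * A$3$1 - A$2$1 * A$3$3, A$1$1 * A$3$3 - A$1$3 * A$3$1, A$1$3 * A$2$1 - A$1$1 * A$2$3],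
     vector [A$2$1 * A$3$2 - A$2$2 * A$3$1, A$1$2 * A$3$1 - A$1$1 * A$3$2, A$1$1 * A$2$2 - A$1$2 * A$2$1]]"

lemma matrix_mult_adjugate3: "A ** adjugate3 A = det A *\<^sub>R mat 1"
  by (simp add: vec_eq_iff forall_3 matrix_matrix_mult_def sum_3 adjugate3_def det_3 mat_def algebra_simps)

lemma matrix_inv_left: "invertible A \<Longrightarrow> matrix_inv A ** A = mat 1"
  unfolding matrix_inv_def invertible_def by (rule someI2_ex) auto

lemma adjugate3_eq:
  assumes "invertible A"
  shows "adjugate3 A = det A *\<^sub>R matrix_inv A"
proof -
  have "adjugate3 A = matrix_inv A ** (A ** adjugate3 A)"
    using assms by (simp add: matrix_inv_left matrix_mul_assoc)
  also have "\<dots> = det A *\<^sub>R matrix_inv A"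
    by (simp add: matrix_mult_adjugate3 matrix_scalar_ac flip: scalar_matrix_assoc)
  finally show ?thesis .
qed

lemma grad_pullback:
  fixes \<phi> :: "real^'n \<Rightarrow> real^'n"
  assumes "\<phi> differentiable (at x)" "u differentiable (at (\<phi> x))"
  shows "grad (\<lambda>x. u (\<phi> x)) x = transpose (jacobian \<phi> (at x)) *v grad u (\<phi> x)"
  by (simp add: vec_eq_iff grad_nth pd_compose[OF assms] matrix_vector_mult_def transpose_def
      jacobian_pd[OF assms(1)] mult.commute)

section \<open>Covariant and contravariant Piola pullbacks in three dimensions\<close>

context
  fixes \<phi> u :: "real^3 \<Rightarrow> real^3"
  assumes \<phi>: "smooth_on UNIV \<phi>" and u: "smooth_on UNIV u"
begin

private abbreviation "J \<equiv> \<lambda>m i. pd i (\<lambda>x. \<phi> x $ m)"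
private abbreviation "c \<equiv> \<lambda>m x. u (\<phi> x) $ m"

private lemma jac: "jacobian \<phi> (at x) $ m $ i = J m i x"
  by (simp add: jacobian_pd_smooth[OF \<phi>])

private lemma smooth_J: "smooth_on UNIV (J m i)"
  by (intro smooth_on_pd smooth_on_nth \<phi> open_UNIV)

private lemma diff_J: "J m i differentiable (at x)"
  by (rule smooth_on_differentiable[OF smooth_J]) simp

private lemma smooth_c: "smooth_on UNIV (c m)"
  by (intro smooth_on_nth smooth_on_compose[OF _ _ _ u \<phi>]) auto

private lemma diff_c: "c m differentiable (at x)"
  by (rule smooth_on_differentiable[OF smooth_c]) simp

private lemma pd_c: "pd k (c m) x = (\<Sum>l\<in>UNIV. jacobian u (at (\<phi> x)) $ m $ l * J l k x)"
proof -
  have "(\<lambda>y. u y $ m) differentiable (at (\<phi> x))"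
    by (rule smooth_on_differentiable[OF smooth_on_nth[OF open_UNIV u]]) simp
  from pd_compose[OF smooth_on_differentiable[OF \<phi>] this] show ?thesis
    by (simp add: jacobian_pd_smooth[OF u])
qed

text \<open>Oriented so that the smaller index ends up outermost: as rewrite rules these bring
  second derivatives of \<open>\<phi>\<close> to one normal form without looping.\<close>

private lemma pd_J: "pd 2 (J m 1) x = pd 1 (J m 2) x" "pd 3 (J m 1) x = pd 1 (J m 3) x"
  "pd 3 (J m 2) x = pd 2 (J m 3) x"
  by (intro pd_commute[OF open_UNIV smooth_on_nth[OF open_UNIV \<phi>]] UNIV_I)+

private lemmas pd_rules = pd_add pd_diff pd_mult differentiable_add differentiable_diff
  differentiable_mult diff_J diff_c

lemma smooth_on_covariant_pullback:
  "smooth_on UNIV (\<lambda>x. transpose (jacobian \<phi> (at x)) *v u (\<phi> x))"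
  by (rule smooth_on_vec)
    (auto simp: matrix_vector_mult_def transpose_def jac intro!: smooth_on_sum smooth_on_mult smooth_J smooth_c)

lemma smooth_on_contravariant_pullback:
  "smooth_on UNIV (\<lambda>x. adjugate3 (jacobian \<phi> (at x)) *v u (\<phi> x))"
proof (rule smooth_on_vec)
  fix i :: 3
  show "smooth_on UNIV (\<lambda>x. (adjugate3 (jacobian \<phi> (at x)) *v u (\<phi> x)) $ i)"
    using exhaust_3[of i]
    by (elim disjE)
      (simp_all add: matrix_vector_mult_def sum_3 adjugate3_def jac smooth_on_intros smooth_J smooth_c)
qed simp

text \<open>The product rule yields second derivatives of \<open>\<phi>\<close> times
  \<open>u\<close>, which cancel by symmetry, and first derivatives of \<open>u\<close> times
  two-by-two minors of the Jacobian, which are the adjugate entries.\<close>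

lemma curl_pullback:
  "curl (\<lambda>x. transpose (jacobian \<phi> (at x)) *v u (\<phi> x)) x
    = adjugate3 (jacobian \<phi> (at x)) *v curl u (\<phi> x)"
proof -
  have nth: "(\<lambda>x. (transpose (jacobian \<phi> (at x)) *v u (\<phi> x)) $ i)
      = (\<lambda>x. J 1 i x * c 1 x + J 2 i x * c 2 x + J 3 i x * c 3 x)" for i
    by (simp add: matrix_vector_mult_def transpose_def jac sum_3)
  have "jacobian (\<lambda>x. transpose (jacobian \<phi> (at x)) *v u (\<phi> x)) (at x) $ i $ k
      = pd k (\<lambda>x. J 1 i x * c 1 x + J 2 i x * c 2 x + J 3 i x * c 3 x) x" for i k
    unfolding nth[symmetric] by (rule jacobian_pd_smooth[OF smooth_on_covariant_pullback UNIV_I])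
  then show ?thesis
    by (simp add: vec_eq_iff forall_3 curl_nth matrix_vector_mult_def adjugate3_def jac sum_3)
      (simp add: pd_rules pd_c pd_J sum_3 algebra_simps)
qed

text \<open>By the Piola identity the columns of the adjugate are divergence-free, again by symmetry
  of second derivatives. What remains is the trace of the adjugate times \<open>Du\<close> times
  \<open>J\<close>, which is \<open>det J\<close> times the trace of \<open>Du\<close> by
  cyclicity.\<close>

lemma divergence_pullback:
  "divergence (\<lambda>x. adjugate3 (jacobian \<phi> (at x)) *v u (\<phi> x)) x
    = det (jacobian \<phi> (at x)) * divergence u (\<phi> x)"
proof -
  have jac': "jacobian (\<lambda>x. adjugate3 (jacobian \<phi> (at x)) *v u (\<phi> x)) (at x) $ i $ k
      = pd k (\<lambda>x. (adjugate3 (jacobian \<phi> (at x)) *v u (\<phi> x)) $ i) x" for i k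
    by (rule jacobian_pd_smooth[OF smooth_on_contravariant_pullback UNIV_I])
  show ?thesis
    unfolding divergence_def trace_def sum_3 jac'
    by (simp add: sum_3 matrix_vector_mult_def adjugate3_def jac det_3)
      (simp add: pd_rules pd_c pd_J sum_3 algebra_simps)
qed

end


lemma jacobian_cong:
  assumes "open S" "x \<in> S" "v differentiable (at x)" "\<And>x. x \<in> S \<Longrightarrow> v x = w x"
  shows "jacobian v (at x) = jacobian w (at x)"
  unfolding jacobian_def using frechet_derivative_transform_within_open[OF assms(3,1,2,4)] by simp


section \<open>The geometry of the shrinking map\<close>

text \<open>On a kernel vector \<open>v\<close> of \<open>A\<close> the matrix
  \<open>A - mat 1\<close> acts as minus the identity, so the norm of \<open>v\<close> is at most
  half of itself. This gives \<open>matrix_inv\<close> its meaning and makes the shrinking map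
  locally open.\<close>

lemma invertible_near_identity:
  fixes A :: "real^'n^'n"
  assumes "matrix_norm (A - mat 1) \<le> 1 / 2"
  shows "invertible A"
proof -
  have "v = 0" if "A *v v = 0" for v
  proof -
    have "(A - mat 1) *v v = - v"
      using that by (simp add: matrix_vector_mult_diff_rdistrib)
    then have "norm v \<le> matrix_norm (A - mat 1) * norm v"
      using onorm[OF matrix_vector_mul_bounded_linear[of "A - mat 1"], of v] by (simp add: matrix_norm_def)
    also have "\<dots> \<le> 1 / 2 * norm v" by (intro mult_right_mono assms) simp
    finally show "v = 0" by simp
  qed
  then show ?thesis
    by (simp add: invertible_left_inverse matrix_left_invertible_ker)
qed

text \<open>The images of the shrinking map form an open set, so the balls around all images near
  \<open>\<phi> x\<close> are available; this upgrades open balls to closed ones.\<close>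

lemma cball_image_subset:
  fixes \<phi> :: "real^'n \<Rightarrow> real^'n"
  assumes "open D" "smooth_on UNIV \<phi>" "\<And>x. x \<in> D \<Longrightarrow> ball (\<phi> x) s \<subseteq> D" "s > 0" "x \<in> D"
    "invertible (jacobian \<phi> (at x))"
  shows "cball (\<phi> x) s \<subseteq> D"
proof
  fix z assume z: "z \<in> cball (\<phi> x) s"
  obtain B where B: "jacobian \<phi> (at x) ** B = mat 1"
    using assms(6) by (auto simp: invertible_def)
  have "(\<phi> has_derivative (\<lambda>h. jacobian \<phi> (at x) *v h)) (at x)"
    using smooth_on_differentiable[OF assms(2) UNIV_I] by (simp add: jacobian_works)
  moreover have "(\<lambda>h. jacobian \<phi> (at x) *v h) \<circ> (\<lambda>h. B *v h) = id"
    by (simp add: fun_eq_iff matrix_vector_mul_assoc B)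
  ultimately have "\<phi> x \<in> interior (\<phi> ` D)"
    using assms(1,5) smooth_on_continuous_on[OF smooth_on_subset[OF assms(2)]]
    by (intro sussmann_open_mapping[OF assms(1) _ assms(5) _ matrix_vector_mul_bounded_linear[of B]])
      (simp_all add: interior_open)
  then obtain e where e: "e > 0" "ball (\<phi> x) e \<subseteq> \<phi> ` D"
    by (auto simp: mem_interior)
  \<comment> \<open>The image \<open>\<phi> x\<close> is moved towards \<open>z\<close> by the
    fraction \<open>t\<close>. The factor 2 keeps the new point within \<open>e\<close>, so it is an
    image too, while its distance to \<open>z\<close> has dropped to at most
    \<open>(1 - t) * s\<close>, strictly below \<open>s\<close>.\<close>
  define t where "t = min 1 (e / (2 * s))"
  have t: "0 < t" "t \<le> 1" "t * s < e"
    using e(1) assms(4) by (auto simp: t_def min_def field_simps)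
  define y where "y = \<phi> x + t *\<^sub>R (z - \<phi> x)"
  have "dist (\<phi> x) y = t * dist (\<phi> x) z"
    using t by (simp add: y_def dist_norm norm_minus_commute)
  also have "\<dots> \<le> t * s" using z t by (intro mult_left_mono) auto
  finally have "y \<in> ball (\<phi> x) e" using t by simp
  then obtain x' where x': "x' \<in> D" "y = \<phi> x'" using e by auto
  have "z - y = (1 - t) *\<^sub>R (z - \<phi> x)" by (simp add: y_def algebra_simps)
  then have "dist y z = (1 - t) * dist (\<phi> x) z"
    using t by (simp add: dist_norm norm_minus_commute[of _ z])
  also have "\<dots> \<le> (1 - t) * s" using z t by (intro mult_left_mono) auto
  also have "\<dots> < s" using t assms(4) by (simp add: algebra_simps)
  finally have "z \<in> ball y s" by simp
  then show "z \<in> D" using assms(3)[OF x'(1)] x'(2) by blast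
qed

lemma smooth_on_shrink: "smooth_on UNIV j \<Longrightarrow> smooth_on UNIV (shrink j \<delta>)"
  unfolding shrink_def[abs_def]
  by (intro smooth_on_diff smooth_on_ident smooth_on_linear[OF _ bounded_linear_scaleR_right] open_UNIV)


section \<open>The complex of weak derivatives\<close>

lemma zero_in_Lp: "(\<lambda>x. 0) \<in> Lp p D"
  by (auto simp: Lp_def set_borel_measurable_def set_integrable_def)

lemma locally_integrable_on_zero: "locally_integrable_on D (\<lambda>x. 0)"
  by (simp add: locally_integrable_on_def set_integrable_def)

lemma test_functions_curl: "\<psi> \<in> test_functions D \<Longrightarrow> (\<lambda>x. curl \<psi> x $ i) \<in> test_functions D"
proof -
  assume \<psi>: "\<psi> \<in> test_functions D"
  have "(\<lambda>x. jacobian \<psi> (at x) $ i $ k) \<in> test_functions D" for i k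
    unfolding jacobian_nth
    by (rule test_functions_linear[OF test_functions_frechet[OF \<psi>] bounded_linear_vec_nth])
  then show ?thesis
    using exhaust_3[of i] by (auto simp: curl_nth intro!: test_functions_diff)
qed

lemma test_functions_smooth: "\<phi> \<in> test_functions D \<Longrightarrow> smooth_on UNIV \<phi>"
  by (simp add: test_functions_def)

text \<open>The components of \<open>curl \<psi>\<close> are scalar test functions. Moving the weak
  gradient onto them leaves \<open>f\<close> times the divergence of \<open>curl \<psi>\<close>,
  which vanishes.\<close>

lemma weak_curl_weak_grad:
  fixes f :: "real^3 \<Rightarrow> real"
  assumes "has_weak_grad D f h" "integrable lebesgue (zero_ext D f)" "integrable lebesgue (zero_ext D h)"
  shows "has_weak_curl D h (\<lambda>x. 0)"
  unfolding has_weak_curl_def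
proof (intro conjI ballI locally_integrable_on_zero)
  show "locally_integrable_on D h" using assms(1) by (simp add: has_weak_grad_def)
  fix \<psi> :: "real^3 \<Rightarrow> real^3" assume \<psi>: "\<psi> \<in> test_functions D"
  define q where "q = (\<lambda>i x. curl \<psi> x $ i)"
  have q: "q i \<in> test_functions D" for i
    unfolding q_def by (rule test_functions_curl[OF \<psi>])
  have int: "integrable lebesgue (\<lambda>x. q i x * zero_ext D h x $ i)" for i
    using integrable_bounded_linear[OF bounded_linear_vec_nth integrable_test_function_scaleR[OF q assms(3), of _ 0]]
    by simp
  have int': "integrable lebesgue (\<lambda>x. pd i (q i) x * zero_ext D f x)" for i
    using integrable_test_function_scaleR[OF test_functions_pd[OF q] assms(2), of _ _ 0] by simp
  have div: "(\<Sum>i\<in>UNIV. pd i (q i) x) = 0" for x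
    using divergence_curl[OF open_UNIV test_functions_smooth[OF \<psi>], of x]
    by (simp add: divergence_def trace_def q_def
        jacobian_pd_smooth[OF smooth_on_curl[OF open_UNIV test_functions_smooth[OF \<psi>]]])
  have "(LINT x:D|lebesgue. h x \<bullet> curl \<psi> x) = (LINT x|lebesgue. (\<Sum>i\<in>UNIV. q i x * zero_ext D h x $ i))"
    by (simp add: set_lebesgue_integral_def zero_ext_def inner_vec_def q_def sum_distrib_left mult_ac)
  also have "\<dots> = (\<Sum>i\<in>UNIV. (LINT x|lebesgue. q i x * zero_ext D h x $ i))"
    by (rule Bochner_Integration.integral_sum) (rule int)
  also have "\<dots> = - (\<Sum>i\<in>UNIV. (LINT x|lebesgue. pd i (q i) x * zero_ext D f x))"
    by (simp add: weak_grad_component[OF assms q] sum_negf)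
  also have "(\<Sum>i\<in>UNIV. (LINT x|lebesgue. pd i (q i) x * zero_ext D f x))
      = (LINT x|lebesgue. (\<Sum>i\<in>UNIV. pd i (q i) x * zero_ext D f x))"
    by (rule Bochner_Integration.integral_sum[symmetric]) (rule int')
  also have "\<dots> = 0" by (simp add: div flip: sum_distrib_right)
  finally show "(LINT x:D|lebesgue. h x \<bullet> curl \<psi> x) = (LINT x:D|lebesgue. 0 \<bullet> \<psi> x)"
    by (simp add: set_lebesgue_integral_def)
qed

text \<open>The dual argument: \<open>grad \<phi>\<close> is an admissible vector test function, and
  its curl vanishes.\<close>

lemma weak_div_weak_curl:
  assumes "has_weak_curl D g w"
  shows "has_weak_div D w (\<lambda>x. 0)"
  unfolding has_weak_div_def
proof (intro conjI ballI locally_integrable_on_zero)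
  show "locally_integrable_on D w" using assms by (simp add: has_weak_curl_def)
  fix \<phi> :: "real^3 \<Rightarrow> real" assume \<phi>: "\<phi> \<in> test_functions D"
  have "grad \<phi> \<in> test_functions D"
    by (rule test_functions_vec) (simp add: grad_nth test_functions_pd \<phi>)
  then have "(LINT x:D|lebesgue. w x \<bullet> grad \<phi> x) = (LINT x:D|lebesgue. g x \<bullet> curl (grad \<phi>) x)"
    using assms by (simp add: has_weak_curl_def)
  also have "\<dots> = 0"
    by (simp add: curl_grad[OF open_UNIV test_functions_smooth[OF \<phi>]] set_lebesgue_integral_def)
  finally show "(LINT x:D|lebesgue. w x \<bullet> grad \<phi> x) = - (LINT x:D|lebesgue. 0 * \<phi> x)"
    by (simp add: set_lebesgue_integral_def)
qed

text \<open>Weak derivatives being relations, each identity is claimed for every representative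
  \<open>h\<close> or \<open>w\<close> in \<open>Lp\<close>, and yet at every point of
  \<open>D\<close>: the integrals defining the operators do not see null sets.\<close>

theorem lemma3p2:
  fixes D :: "(real^3) set" and j :: "real^3 \<Rightarrow> real^3"
    and r \<delta>\<^sub>0 \<delta> :: real and p :: ennreal
  assumes "open D" and "bounded D" and "connected D" and "strongly_lipschitz D"
    and "smooth_on UNIV j"
    and "\<forall>z\<in>frontier D. norm (j z) = 1"
    and "globally_transversal D j"
    and "r > 0"
    and "\<forall>s\<in>{0..1}.
           {shrink j s x + b | x b. x \<in> D \<and> b \<in> (if s = 0 then {0} else ball 0 (s * r))} \<subseteq> D"
    and "0 < \<delta>\<^sub>0" and "\<delta>\<^sub>0 \<le> 1"
    and "\<forall>s\<in>{0..\<delta>\<^sub>0}. \<forall>x\<in>D.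
           matrix_norm (Jac j s x - mat 1) \<le> 1 / 2 \<and>
           matrix_norm (matrix_inv (Jac j s x)) \<le> 2 \<and>
           \<bar>det (matrix_inv (Jac j s x))\<bar> \<le> 2 ^ 3"
    and "1 \<le> p"
    and "0 < \<delta>" and "\<delta> \<le> \<delta>\<^sub>0"
  shows
    \<comment> \<open>(i), (ii), (iii)\<close>
    "(\<forall>f\<in>Zg p D. \<forall>h\<in>Lp p D. has_weak_grad D f h \<longrightarrow>
        (\<forall>x\<in>D. grad (Kg j r \<delta> f) x = Kc j r \<delta> h x)) \<and>
     (\<forall>g\<in>Zc p D. \<forall>w\<in>Lp p D. has_weak_curl D g w \<longrightarrow>
        (\<forall>x\<in>D. curl (Kc j r \<delta> g) x = Kd j r \<delta> w x)) \<and>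
     (\<forall>g\<in>Zd p D. \<forall>w\<in>Lp p D. has_weak_div D g w \<longrightarrow>
        (\<forall>x\<in>D. divergence (Kd j r \<delta> g) x = Kb j r \<delta> w x)) \<and>
     \<comment> \<open>the vertical arrows of the diagram\<close>
     (\<forall>f\<in>Zg p D. smooth_on D (Kg j r \<delta> f)) \<and>
     (\<forall>g\<in>Zc p D. smooth_on D (Kc j r \<delta> g)) \<and>
     (\<forall>g\<in>Zd p D. smooth_on D (Kd j r \<delta> g)) \<and>
     (\<forall>f\<in>Lp p D. smooth_on D (Kb j r \<delta> f)) \<and>
     \<comment> \<open>the upper row is a complex\<close>
     (\<forall>f\<in>Zg p D. \<forall>h\<in>Lp p D. has_weak_grad D f h \<longrightarrow>
        h \<in> Zc p D \<and> has_weak_curl D h (\<lambda>x. 0)) \<and>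
     (\<forall>g\<in>Zc p D. \<forall>w\<in>Lp p D. has_weak_curl D g w \<longrightarrow>
        w \<in> Zd p D \<and> has_weak_div D w (\<lambda>x. 0)) \<and>
     \<comment> \<open>the lower row is a complex\<close>
     (\<forall>u. smooth_on D u \<longrightarrow> smooth_on D (grad u) \<and> (\<forall>x\<in>D. curl (grad u) x = 0)) \<and>
     (\<forall>v. smooth_on D v \<longrightarrow> smooth_on D (curl v) \<and> (\<forall>x\<in>D. divergence (curl v) x = 0)) \<and>
     (\<forall>v :: real^3 \<Rightarrow> real^3. smooth_on D v \<longrightarrow> smooth_on D (divergence v))"
proof -
  define s where "s = \<delta> * r"
  define \<phi> where "\<phi> = shrink j \<delta>"
  define M :: "(real^3 \<Rightarrow> real) \<Rightarrow> real^3 \<Rightarrow> real"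
    where "M f = mollify (scaled_kernel s) (zero_ext D f)" for f
  define N :: "(real^3 \<Rightarrow> real^3) \<Rightarrow> real^3 \<Rightarrow> real^3"
    where "N g = mollify (scaled_kernel s) (zero_ext D g)" for g
  have s: "s > 0" using assms(8,14) by (simp add: s_def)
  have \<phi>: "smooth_on UNIV \<phi>" unfolding \<phi>_def by (rule smooth_on_shrink[OF assms(5)])
  have Jac: "Jac j \<delta> x = jacobian \<phi> (at x)" for x by (simp add: Jac_def \<phi>_def)
  have ball: "ball (\<phi> x) s \<subseteq> D" if "x \<in> D" for x
  proof
    fix z assume "z \<in> ball (\<phi> x) s"
    then have "z = shrink j \<delta> x + (z - \<phi> x)" "z - \<phi> x \<in> ball 0 (\<delta> * r)"
      by (simp_all add: \<phi>_def s_def dist_norm norm_minus_commute)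
    \<comment> \<open>That \<open>\<delta>\<close> is nonzero selects the branch of the shrinking
      hypothesis with a genuine ball.\<close>
    moreover have "\<delta> \<in> {0..1}" "\<delta> \<noteq> 0" using assms(11,14,15) by auto
    ultimately show "z \<in> D" using assms(9) that by fastforce
  qed
  have inv: "invertible (jacobian \<phi> (at x))" if "x \<in> D" for x
    using assms(12,14,15) that by (intro invertible_near_identity) (auto simp flip: Jac)
  have cball: "cball (\<phi> x) s \<subseteq> D" if "x \<in> D" for x
    by (rule cball_image_subset[OF assms(1) \<phi> ball s that inv[OF that]])
  note ker = scaled_kernel_test_function[OF s]
  note Lp_int = Lp_integrable_zero_ext[OF _ assms(1,2,13)]
  have smooth_M: "smooth_on UNIV (M f)" if "f \<in> Lp p D" for f
    unfolding M_def by (rule smooth_on_mollify[OF ker Lp_int[OF that]])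
  have smooth_N: "smooth_on UNIV (N g)" if "g \<in> Lp p D" for g
    unfolding N_def by (rule smooth_on_mollify[OF ker Lp_int[OF that]])
  have Kg: "Kg j r \<delta> f x = M f (\<phi> x)" if "f \<in> Lp p D" "x \<in> D" for f x
    using Kg_eq[of \<delta> r D f j x] s ball[OF that(2)] Lp_int[OF that(1)] by (simp add: M_def \<phi>_def s_def)
  have Kc: "Kc j r \<delta> g x = transpose (jacobian \<phi> (at x)) *v N g (\<phi> x)" if "g \<in> Lp p D" "x \<in> D" for g x
    using Kc_eq[of \<delta> r D g j x] s ball[OF that(2)] Lp_int[OF that(1)]
    by (simp add: N_def \<phi>_def s_def Jac_def)
  \<comment> \<open>On \<open>D\<close> the Jacobian is invertible and the two forms agree; the
    right-hand side remains smooth beyond \<open>D\<close>, where the Jacobian may be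
    singular.\<close>
  have Kd: "Kd j r \<delta> g x = adjugate3 (jacobian \<phi> (at x)) *v N g (\<phi> x)" if "g \<in> Lp p D" "x \<in> D" for g x
    using Kd_eq[of \<delta> r D g j x] s ball[OF that(2)] Lp_int[OF that(1)]
    by (simp add: N_def \<phi>_def s_def Jac adjugate3_eq[OF inv[OF that(2)], unfolded \<phi>_def] scaleR_matrix_vector_assoc)
  have Kb: "Kb j r \<delta> f x = det (jacobian \<phi> (at x)) * M f (\<phi> x)" if "f \<in> Lp p D" "x \<in> D" for f x
    using Kb_eq[of \<delta> r D f j x] s ball[OF that(2)] Lp_int[OF that(1)]
    by (simp add: M_def \<phi>_def s_def Jac_def)
  have M_\<phi>: "smooth_on UNIV (\<lambda>x. M f (\<phi> x))" if "f \<in> Lp p D" for f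
    by (rule smooth_on_compose[OF _ _ _ smooth_M[OF that] \<phi>]) auto
  note cov = smooth_on_covariant_pullback[OF \<phi> smooth_N]
  note con = smooth_on_contravariant_pullback[OF \<phi> smooth_N]
  note on_D = smooth_on_subset[OF _ subset_UNIV[of D]]

  have "grad (Kg j r \<delta> f) x = Kc j r \<delta> h x"
    if "f \<in> Zg p D" "h \<in> Lp p D" "has_weak_grad D f h" "x \<in> D" for f h x
  proof -
    have f: "f \<in> Lp p D" using that(1) by (simp add: Zg_def)
    \<comment> \<open>The operator equals the pullback on \<open>D\<close> only; since
      \<open>D\<close> is open this already determines the derivative at \<open>x\<close>. The curl
      and the divergence are treated in the same way through their Jacobians.\<close>
    have "pd i (\<lambda>x. M f (\<phi> x)) x = pd i (Kg j r \<delta> f) x" for i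
      by (rule pd_cong[OF assms(1) that(4) smooth_on_differentiable[OF M_\<phi>[OF f] UNIV_I]])
        (simp add: Kg[OF f])
    then have "grad (Kg j r \<delta> f) x = grad (\<lambda>x. M f (\<phi> x)) x"
      by (simp add: vec_eq_iff grad_nth)
    also have "\<dots> = transpose (jacobian \<phi> (at x)) *v grad (M f) (\<phi> x)"
      by (intro grad_pullback smooth_on_differentiable[OF \<phi>] smooth_on_differentiable[OF smooth_M[OF f]] UNIV_I)
    also have "grad (M f) (\<phi> x) = N h (\<phi> x)"
      unfolding M_def N_def by (rule grad_mollify[OF that(3) Lp_int[OF f] Lp_int[OF that(2)] ker cball[OF that(4)]])
    finally show ?thesis by (simp add: Kc[OF that(2,4)])
  qed
  moreover have "curl (Kc j r \<delta> g) x = Kd j r \<delta> w x"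
    if "g \<in> Zc p D" "w \<in> Lp p D" "has_weak_curl D g w" "x \<in> D" for g w x
  proof -
    have g: "g \<in> Lp p D" using that(1) by (simp add: Zc_def)
    have "jacobian (\<lambda>x. transpose (jacobian \<phi> (at x)) *v N g (\<phi> x)) (at x) = jacobian (Kc j r \<delta> g) (at x)"
      by (rule jacobian_cong[OF assms(1) that(4) smooth_on_differentiable[OF cov[OF g] UNIV_I]])
        (simp add: Kc[OF g])
    then have "curl (Kc j r \<delta> g) x = curl (\<lambda>x. transpose (jacobian \<phi> (at x)) *v N g (\<phi> x)) x"
      by (simp add: curl_def)
    also have "\<dots> = adjugate3 (jacobian \<phi> (at x)) *v curl (N g) (\<phi> x)"
      by (rule curl_pullback[OF \<phi> smooth_N[OF g]])
    also have "curl (N g) (\<phi> x) = N w (\<phi> x)"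
      unfolding N_def by (rule curl_mollify[OF that(3) Lp_int[OF g] Lp_int[OF that(2)] ker cball[OF that(4)]])
    finally show ?thesis by (simp add: Kd[OF that(2,4)])
  qed
  moreover have "divergence (Kd j r \<delta> g) x = Kb j r \<delta> w x"
    if "g \<in> Zd p D" "w \<in> Lp p D" "has_weak_div D g w" "x \<in> D" for g w x
  proof -
    have g: "g \<in> Lp p D" using that(1) by (simp add: Zd_def)
    have "jacobian (\<lambda>x. adjugate3 (jacobian \<phi> (at x)) *v N g (\<phi> x)) (at x) = jacobian (Kd j r \<delta> g) (at x)"
      by (rule jacobian_cong[OF assms(1) that(4) smooth_on_differentiable[OF con[OF g] UNIV_I]])
        (simp add: Kd[OF g])
    then have "divergence (Kd j r \<delta> g) x = divergence (\<lambda>x. adjugate3 (jacobian \<phi> (at x)) *v N g (\<phi> x)) x"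
      by (simp add: divergence_def)
    also have "\<dots> = det (jacobian \<phi> (at x)) * divergence (N g) (\<phi> x)"
      by (rule divergence_pullback[OF \<phi> smooth_N[OF g]])
    also have "divergence (N g) (\<phi> x) = M w (\<phi> x)"
      unfolding N_def M_def by (rule divergence_mollify[OF that(3) Lp_int[OF g] Lp_int[OF that(2)] ker cball[OF that(4)]])
    finally show ?thesis by (simp add: Kb[OF that(2,4)])
  qed
  moreover have "smooth_on D (Kg j r \<delta> f)" if "f \<in> Zg p D" for f
    using that by (intro smooth_on_cong[OF assms(1) _ on_D[OF M_\<phi>]]) (auto simp: Zg_def Kg)
  moreover have "smooth_on D (Kc j r \<delta> g)" if "g \<in> Zc p D" for g
    using that by (intro smooth_on_cong[OF assms(1) _ on_D[OF cov]]) (auto simp: Zc_def Kc)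
  moreover have "smooth_on D (Kd j r \<delta> g)" if "g \<in> Zd p D" for g
    using that by (intro smooth_on_cong[OF assms(1) _ on_D[OF con]]) (auto simp: Zd_def Kd)
  moreover have "smooth_on D (Kb j r \<delta> f)" if "f \<in> Lp p D" for f
    using that
    by (intro smooth_on_cong[OF assms(1) _ on_D[OF smooth_on_mult[OF open_UNIV smooth_on_det_jacobian[OF open_UNIV \<phi>] M_\<phi>]]])
      (auto simp: Kb)
  moreover have "h \<in> Zc p D \<and> has_weak_curl D h (\<lambda>x. 0)"
    if "f \<in> Zg p D" "h \<in> Lp p D" "has_weak_grad D f h" for f h
    using weak_curl_weak_grad[OF that(3) Lp_int Lp_int] that zero_in_Lp by (auto simp: Zg_def Zc_def)
  moreover have "w \<in> Zd p D \<and> has_weak_div D w (\<lambda>x. 0)"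
    if "w \<in> Lp p D" "has_weak_curl D g w" for g w
    using weak_div_weak_curl[OF that(2)] that zero_in_Lp by (auto simp: Zd_def)
  ultimately show ?thesis
    using smooth_on_grad[OF assms(1)] smooth_on_curl[OF assms(1)] smooth_on_divergence[OF assms(1)]
      curl_grad[OF assms(1)] divergence_curl[OF assms(1)]
    by (intro conjI) simp_all
qed

end
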